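(* Let $N,k\ge1$ be integers, write $z=(x,y)\in\mathbb{R}^{N}\times\mathbb{R}^k$, and let $\Delta_{\mathcal{G}}=\Delta_x+|x|^2\Delta_y$. Let $0\le\gamma<1$, $p_1,p_2>1$, and let $u_0\in C_0(\mathbb{R}^{N+k})$ with $u_0\ge0$, $u_0\not\equiv0$. If $p_1\gamma\le1$, then the problem $$u_t-\Delta_{\mathcal{G}}u=\int_0^t(t-s)^{-\gamma}|u(s)|^{p_1-1}u(s)\,ds+|u(t)|^{p_2-1}u(t)\ \text{ in }\mathbb{R}^{N+k}\times(0,\infty),\qquad u(z,0)=u_0(z),$$ admits no global nonnegative weak solution $u\in C([0,\infty),C_0(\mathbb{R}^{N+k}))$.
   Context: $C_0(\mathbb{R}^{N+k})$ denotes continuous functions vanishing at infinity. For $T>0$, a function $u$ is a weak solution on $[0,T]$ if $u$, $\int_0^t(t-s)^{-\gamma}|u|^{p_1-1}u(s)\,ds$, $|u|^{p_2-1}u\in L^1_{\mathrm{loc}}(\mathbb{R}^{N+k}\times(0,T))$ and for every compactly supported $\varphi\in C^{2,1}(\mathbb{R}^{N+k}\times[0,T])$ with $\varphi(\cdot,T)=0$, $$-\int_{\mathbb{R}^{N+k}}u_0\varphi(z,0)\,dz=\int_0^T\!\!\int_{\mathbb{R}^{N+k}}\Big(\int_0^t(t-s)^{-\gamma}|u|^{p_1-1}u(z,s)\,ds\Big)\varphi\,dz\,dt+\int_0^T\!\!\int_{\mathbb{R}^{N+k}}|u|^{p_2-1}u\,\varphi\,dz\,dt+\int_0^T\!\!\int_{\mathbb{R}^{N+k}}u\,\Delta_{\mathcal{G}}\varphi\,dz\,dt+\int_0^T\!\!\int_{\mathbb{R}^{N+k}}u\,\varphi_t\,dz\,dt.$$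 A global weak solution is a weak solution on $[0,T]$ for every $T>0$. *)

theory Defs
  imports "HOL-Analysis.Analysis"
begin

text \<open>Points z = (x,y) of R^(N+k) are pairs in real^'n * real^'k, with N = CARD('n),
  k = CARD('k). Space-time functions are curried: u z t.\<close>

type_synonym ('n, 'k) pt = "(real^'n) \<times> (real^'k)"

definition dirz :: "('n::finite + 'k::finite) \<Rightarrow> ('n, 'k) pt" where
  "dirz c = case_sum (\<lambda>i. (axis i 1, 0)) (\<lambda>j. (0, axis j 1)) c"

definition pdz :: "('n::finite + 'k::finite) \<Rightarrow> (('n, 'k) pt \<Rightarrow> real \<Rightarrow> real)
    \<Rightarrow> ('n, 'k) pt \<Rightarrow> real \<Rightarrow> real" where
  "pdz c f z t = deriv (\<lambda>h. f (z + h *\<^sub>R dirz c) t) 0"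

definition pdt :: "real \<Rightarrow> (('n::finite, 'k::finite) pt \<Rightarrow> real \<Rightarrow> real)
    \<Rightarrow> ('n, 'k) pt \<Rightarrow> real \<Rightarrow> real" where
  "pdt T f z t = vector_derivative (\<lambda>s. f z s) (at t within {0..T})"

definition grushin :: "(('n::finite, 'k::finite) pt \<Rightarrow> real \<Rightarrow> real)
    \<Rightarrow> ('n, 'k) pt \<Rightarrow> real \<Rightarrow> real" where
  "grushin f z t = (\<Sum>i\<in>UNIV. pdz (Inl i) (pdz (Inl i) f) z t)
      + (norm (fst z))\<^sup>2 * (\<Sum>j\<in>UNIV. pdz (Inr j) (pdz (Inr j) f) z t)"

definition C21_on :: "real \<Rightarrow> (('n::finite, 'k::finite) pt \<Rightarrow> real \<Rightarrow> real) \<Rightarrow> bool" where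
  "C21_on T \<phi> \<longleftrightarrow>
     continuous_on (UNIV \<times> {0..T}) (\<lambda>w. \<phi> (fst w) (snd w)) \<and>
     (\<forall>c z t. t \<in> {0..T} \<longrightarrow>
        ((\<lambda>h. \<phi> (z + h *\<^sub>R dirz c) t) has_real_derivative pdz c \<phi> z t) (at 0)) \<and>
     (\<forall>c. continuous_on (UNIV \<times> {0..T}) (\<lambda>w. pdz c \<phi> (fst w) (snd w))) \<and>
     (\<forall>c d z t. t \<in> {0..T} \<longrightarrow>
        ((\<lambda>h. pdz c \<phi> (z + h *\<^sub>R dirz d) t) has_real_derivative pdz d (pdz c \<phi>) z t) (at 0)) \<and>
     (\<forall>c d. continuous_on (UNIV \<times> {0..T}) (\<lambda>w. pdz d (pdz c \<phi>) (fst w) (snd w))) \<and>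
     (\<forall>z t. t \<in> {0..T} \<longrightarrow>
        ((\<lambda>s. \<phi> z s) has_real_derivative pdt T \<phi> z t) (at t within {0..T})) \<and>
     continuous_on (UNIV \<times> {0..T}) (\<lambda>w. pdt T \<phi> (fst w) (snd w))"

definition compact_supp_on :: "real \<Rightarrow> (('n::finite, 'k::finite) pt \<Rightarrow> real \<Rightarrow> real) \<Rightarrow> bool" where
  "compact_supp_on T \<phi> \<longleftrightarrow>
     (\<exists>K. compact K \<and> (\<forall>z t. t \<in> {0..T} \<and> \<phi> z t \<noteq> 0 \<longrightarrow> z \<in> K))"

definition test_fun :: "real \<Rightarrow> (('n::finite, 'k::finite) pt \<Rightarrow> real \<Rightarrow> real) \<Rightarrow> bool" where
  "test_fun T \<phi> \<longleftrightarrow> C21_on T \<phi> \<and> compact_supp_on T \<phi> \<and> (\<forall>z. \<phi> z T = 0)"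

definition loc_L1 :: "real \<Rightarrow> (('n::finite, 'k::finite) pt \<Rightarrow> real \<Rightarrow> real) \<Rightarrow> bool" where
  "loc_L1 T f \<longleftrightarrow> (\<forall>K. compact K \<and> K \<subseteq> UNIV \<times> {0<..<T} \<longrightarrow>
       set_integrable lborel K (\<lambda>w. f (fst w) (snd w)))"

definition spow :: "real \<Rightarrow> real \<Rightarrow> real" where
  "spow p v = \<bar>v\<bar> powr (p - 1) * v"

definition memory :: "real \<Rightarrow> real \<Rightarrow> (('n::finite, 'k::finite) pt \<Rightarrow> real \<Rightarrow> real)
    \<Rightarrow> ('n, 'k) pt \<Rightarrow> real \<Rightarrow> real" where
  "memory \<gamma> p u z t = (LINT s:{0..t}|lborel. (t - s) powr (- \<gamma>) * spow p (u z s))"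

definition weak_solution :: "real \<Rightarrow> real \<Rightarrow> real \<Rightarrow> (('n::finite, 'k::finite) pt \<Rightarrow> real)
    \<Rightarrow> real \<Rightarrow> (('n, 'k) pt \<Rightarrow> real \<Rightarrow> real) \<Rightarrow> bool" where
  "weak_solution \<gamma> p1 p2 u0 T u \<longleftrightarrow>
     loc_L1 T u \<and> loc_L1 T (memory \<gamma> p1 u) \<and> loc_L1 T (\<lambda>z t. spow p2 (u z t)) \<and>
     (\<forall>\<phi>. test_fun T \<phi> \<longrightarrow>
        - (LINT z|lborel. u0 z * \<phi> z 0)
        = (LINT w:UNIV \<times> {0<..<T}|lborel. memory \<gamma> p1 u (fst w) (snd w) * \<phi> (fst w) (snd w))
        + (LINT w:UNIV \<times> {0<..<T}|lborel. spow p2 (u (fst w) (snd w)) * \<phi> (fst w) (snd w))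
        + (LINT w:UNIV \<times> {0<..<T}|lborel. u (fst w) (snd w) * grushin \<phi> (fst w) (snd w))
        + (LINT w:UNIV \<times> {0<..<T}|lborel. u (fst w) (snd w) * pdt T \<phi> (fst w) (snd w)))"

definition global_weak_solution :: "real \<Rightarrow> real \<Rightarrow> real \<Rightarrow> (('n::finite, 'k::finite) pt \<Rightarrow> real)
    \<Rightarrow> (('n, 'k) pt \<Rightarrow> real \<Rightarrow> real) \<Rightarrow> bool" where
  "global_weak_solution \<gamma> p1 p2 u0 u \<longleftrightarrow> (\<forall>T>0. weak_solution \<gamma> p1 p2 u0 T u)"

definition C0 :: "(('n::finite, 'k::finite) pt \<Rightarrow> real) \<Rightarrow> bool" where
  "C0 f \<longleftrightarrow> continuous_on UNIV f \<and> (f \<longlongrightarrow> 0) at_infinity"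

definition C_C0 :: "(('n::finite, 'k::finite) pt \<Rightarrow> real \<Rightarrow> real) \<Rightarrow> bool" where
  "C_C0 u \<longleftrightarrow> (\<forall>t\<ge>0. C0 (\<lambda>z. u z t)) \<and>
     (\<forall>t\<ge>0. \<forall>\<epsilon>>0. \<exists>\<delta>>0. \<forall>s\<ge>0. \<bar>s - t\<bar> < \<delta> \<longrightarrow> (\<forall>z. \<bar>u z s - u z t\<bar> < \<epsilon>))"

end

theory Submission
  imports Defs
begin

text \<open>
  Test the equation against \<open>\<psi>(z) w(t)^(n+1)\<close>, where \<open>w(t) = 1 - t/T\<close> and \<open>\<psi>\<close> is a fixed
  \<open>C\<^sup>2\<close> bump with \<open>\<Delta>\<^sub>G \<psi> \<ge> - \<Lambda> \<psi>\<close>. Bounding the kernel \<open>(t - s)^(-\<gamma>)\<close> below by \<open>T^(-\<gamma>)\<close> and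
  integrating by parts in time gives, for \<open>T \<ge> 1\<close> and some constants \<open>C\<close> and \<open>c = \<integral>u\<^sub>0 \<psi> > 0\<close>,
  \<open>c + T^(1-\<gamma>)/(n+2) \<integral>\<integral> u^p w^(n+2) \<psi> \<le> C \<integral>\<integral> u w^n \<psi>\<close> with \<open>p = p\<^sub>1\<close>; the second source is
  discarded. By Young's inequality the right-hand side is at most
  \<open>B T^(1-\<gamma>) \<integral>\<integral> u^p w^(n+2) \<psi> + O(B^(-1/(p-1)) T^(1-\<gamma>))\<close> precisely because \<open>p \<gamma> \<le> 1\<close>. A small
  \<open>B\<close> shows that \<open>\<integral>\<integral> u^p \<psi>\<close> is finite over all times; splitting the time axis at a large \<open>A\<close> and
  letting \<open>T\<close>, \<open>A\<close>, \<open>B\<close> tend to infinity in this order shows that it vanishes, and the same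
  inequality at \<open>T = 1\<close> then gives \<open>c \<le> 0\<close>.
\<close>

subsection \<open>A compactly supported sub-eigenfunction of the Grushin operator\<close>

text \<open>The cube of a positive part is twice continuously differentiable, which is the
  regularity in space required of a test function; the powers 2 and 1 arise as its
  derivatives.\<close>

definition ppow :: "nat \<Rightarrow> real \<Rightarrow> real" where
  "ppow n s = max 0 s ^ n"

lemma ppow_nonneg [simp]: "ppow n s \<ge> 0"
  by (simp add: ppow_def)

lemma continuous_on_ppow [continuous_intros]:
  "continuous_on S f \<Longrightarrow> continuous_on S (\<lambda>x. ppow n (f x))"
  unfolding ppow_def by (intro continuous_intros)

text \<open>Away from 0 the outer function is locally zero or a monomial. At the kink the exponent
  is at least 2, so the difference quotient is bounded by \<open>\<bar>y\<bar> ^ Suc n\<close> and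
  tends to 0. The chain rule then covers general \<open>f\<close>.\<close>

lemma has_real_derivative_ppow:
  assumes "(f has_real_derivative f') (at x within S)"
  shows "((\<lambda>x. ppow (Suc (Suc n)) (f x)) has_real_derivative (real n + 2) * ppow (Suc n) (f x) * f') (at x within S)"
proof -
  have "((\<lambda>y. ppow (Suc (Suc n)) y) has_real_derivative (real n + 2) * ppow (Suc n) s) (at s)" for s :: real
  proof (cases s "0 :: real" rule: linorder_cases)
    case less
    have "((\<lambda>y::real. 0::real) has_real_derivative (real n + 2) * ppow (Suc n) s) (at s)"
      using less by (simp add: ppow_def)
    then show ?thesis
      by (rule DERIV_cong_ev[THEN iffD1, rotated -1])
        (use less eventually_nhds_in_open[of "{..<0}" s] in \<open>auto simp: ppow_def max_def elim!: eventually_mono\<close>)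
  next
    case greater
    have "((\<lambda>y::real. y ^ Suc (Suc n)) has_real_derivative real (Suc (Suc n)) * s ^ Suc n) (at s)"
      by (rule DERIV_cong[OF DERIV_pow]) simp
    also have "real (Suc (Suc n)) * s ^ Suc n = (real n + 2) * ppow (Suc n) s"
      using greater by (simp add: ppow_def)
    finally show ?thesis
      by (rule DERIV_cong_ev[THEN iffD1, rotated -1])
        (use greater eventually_nhds_in_open[of "{0<..}" s] in \<open>auto simp: ppow_def max_def elim!: eventually_mono\<close>)
  next
    case equal
    have "((\<lambda>y::real. ppow (Suc (Suc n)) y / y) \<longlongrightarrow> 0) (at 0)"
    proof (rule Lim_null_comparison[OF always_eventually[OF allI]])
      show "norm (ppow (Suc (Suc n)) y / y) \<le> \<bar>y\<bar> ^ Suc n" for y :: real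
        by (cases "y \<le> 0") (auto simp: max_def ppow_def mult_nonpos_nonneg)
      show "((\<lambda>y::real. \<bar>y\<bar> ^ Suc n) \<longlongrightarrow> 0) (at 0)"
        by (auto intro!: tendsto_eq_intros)
    qed
    then show ?thesis using equal by (simp add: has_field_derivative_iff ppow_def)
  qed
  from DERIV_chain2[OF this assms] show ?thesis .
qed

lemma has_real_derivative_ppow_3:
  "(f has_real_derivative f') (at x within S) \<Longrightarrow>
    ((\<lambda>x. ppow 3 (f x)) has_real_derivative 3 * ppow 2 (f x) * f') (at x within S)"
  using has_real_derivative_ppow[where n = 1] by (simp add: eval_nat_numeral)

lemma has_real_derivative_ppow_2:
  "(f has_real_derivative f') (at x within S) \<Longrightarrow>
    ((\<lambda>x. ppow 2 (f x)) has_real_derivative 2 * ppow 1 (f x) * f') (at x within S)"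
  using has_real_derivative_ppow[where n = 0] by (simp add: eval_nat_numeral)

lemma norm_axis_line:
  fixes x :: "real^'m::finite"
  shows "(norm (x + h *\<^sub>R axis i 1))\<^sup>2 = (norm x)\<^sup>2 + 2 * h * x $ i + h\<^sup>2"
proof -
  have "(x + h *\<^sub>R axis i 1) \<bullet> (x + h *\<^sub>R axis i 1) = x \<bullet> x + 2 * h * x $ i + h\<^sup>2"
    by (simp add: inner_simps inner_axis inner_commute[of "axis i 1"] algebra_simps power2_eq_square)
  then show ?thesis by (simp only: power2_norm_eq_inner)
qed

lemma fst_dirz [simp]: "fst (dirz (Inl i)) = axis i 1" "fst (dirz (Inr j)) = 0"
  and snd_dirz [simp]: "snd (dirz (Inl i)) = 0" "snd (dirz (Inr j)) = axis j 1"
  by (auto simp: dirz_def)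

text \<open>A product of two bumps is used since, where \<open>x = 0\<close>, the boundary of a ball in \<open>z\<close> is
  characteristic for the Grushin operator, and a function of \<open>norm z\<close> alone fails to be a
  sub-eigenfunction there.\<close>
definition bump :: "real \<Rightarrow> ('n::finite, 'k::finite) pt \<Rightarrow> real" where
  "bump r z = ppow 3 (r\<^sup>2 - (norm (fst z))\<^sup>2) * ppow 3 (r\<^sup>2 - (norm (snd z))\<^sup>2)"

text \<open>Closed forms make the derivatives in \<open>pdz\<close> computable. The companion
  \<open>ddbump\<close> lists mixed second derivatives too, since \<open>C21_on\<close> asks for all
  of them.\<close>

primrec dbump :: "real \<Rightarrow> ('n::finite + 'k::finite) \<Rightarrow> ('n, 'k) pt \<Rightarrow> real" where
  "dbump r (Inl i) z =
     - 6 * fst z $ i * ppow 2 (r\<^sup>2 - (norm (fst z))\<^sup>2) * ppow 3 (r\<^sup>2 - (norm (snd z))\<^sup>2)"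
| "dbump r (Inr j) z =
     - 6 * snd z $ j * ppow 3 (r\<^sup>2 - (norm (fst z))\<^sup>2) * ppow 2 (r\<^sup>2 - (norm (snd z))\<^sup>2)"

definition ddbump :: "real \<Rightarrow> ('n::finite + 'k::finite) \<Rightarrow> ('n + 'k) \<Rightarrow> ('n, 'k) pt \<Rightarrow> real" where
  "ddbump r c d z = (let a = r\<^sup>2 - (norm (fst z))\<^sup>2; b = r\<^sup>2 - (norm (snd z))\<^sup>2 in
    (case (c, d) of
       (Inl i, Inl j) \<Rightarrow>
         (24 * fst z $ i * fst z $ j * ppow 1 a - 6 * of_bool (i = j) * ppow 2 a) * ppow 3 b
     | (Inl i, Inr j) \<Rightarrow> 36 * fst z $ i * snd z $ j * ppow 2 a * ppow 2 b
     | (Inr i, Inl j) \<Rightarrow> 36 * snd z $ i * fst z $ j * ppow 2 a * ppow 2 b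
     | (Inr i, Inr j) \<Rightarrow>
         (24 * snd z $ i * snd z $ j * ppow 1 b - 6 * of_bool (i = j) * ppow 2 b) * ppow 3 a))"

lemma DERIV_radius_line:
  fixes x :: "real^'m::finite"
  shows "((\<lambda>h. r\<^sup>2 - (norm (x + h *\<^sub>R axis i 1))\<^sup>2) has_real_derivative - 2 * x $ i) (at 0)"
  unfolding norm_axis_line by (auto intro!: derivative_eq_intros)

lemma DERIV_coord_line:
  fixes x :: "real^'m::finite"
  shows "((\<lambda>h. (x + h *\<^sub>R axis i 1) $ j) has_real_derivative (if i = j then 1 else 0)) (at 0)"
  by (auto simp: axis_def intro!: derivative_eq_intros)

lemma DERIV_bump_line:
  "((\<lambda>h. bump r (z + h *\<^sub>R dirz c)) has_real_derivative dbump r c z) (at 0)"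
proof -
  note R3 = has_real_derivative_ppow_3[OF DERIV_radius_line]
  show ?thesis
  proof (cases c)
    fix i assume c: "c = Inl i"
    show ?thesis unfolding c bump_def fst_add snd_add fst_scaleR snd_scaleR fst_dirz snd_dirz
        scaleR_zero_right add_0_right
      by (rule DERIV_cong[OF DERIV_mult[OF R3 DERIV_const]]) auto
  next
    fix i assume c: "c = Inr i"
    show ?thesis unfolding c bump_def fst_add snd_add fst_scaleR snd_scaleR fst_dirz snd_dirz
        scaleR_zero_right add_0_right
      by (rule DERIV_cong[OF DERIV_mult[OF DERIV_const R3]]) auto
  qed
qed

lemma DERIV_dbump_line:
  "((\<lambda>h. dbump r c (z + h *\<^sub>R dirz d)) has_real_derivative ddbump r c d z) (at 0)"
proof -
  note D = DERIV_mult[OF DERIV_mult[OF DERIV_mult[OF DERIV_const]]]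
    and R3 = has_real_derivative_ppow_3[OF DERIV_radius_line]
    and R2 = has_real_derivative_ppow_2[OF DERIV_radius_line]
    and C = DERIV_coord_line
  show ?thesis
  proof (cases c; cases d)
    fix i j assume cd: "c = Inl i" "d = Inl j"
    show ?thesis unfolding cd dbump.simps fst_add snd_add fst_scaleR snd_scaleR fst_dirz snd_dirz
        scaleR_zero_right add_0_right
      by (rule DERIV_cong[OF D[OF C R2 DERIV_const]]) (auto simp: ddbump_def Let_def algebra_simps)
  next
    fix i j assume cd: "c = Inl i" "d = Inr j"
    show ?thesis unfolding cd dbump.simps fst_add snd_add fst_scaleR snd_scaleR fst_dirz snd_dirz
        scaleR_zero_right add_0_right
      by (rule DERIV_cong[OF D[OF DERIV_const DERIV_const R3]]) (auto simp: ddbump_def Let_def algebra_simps)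
  next
    fix i j assume cd: "c = Inr i" "d = Inl j"
    show ?thesis unfolding cd dbump.simps fst_add snd_add fst_scaleR snd_scaleR fst_dirz snd_dirz
        scaleR_zero_right add_0_right
      by (rule DERIV_cong[OF D[OF DERIV_const R3 DERIV_const]]) (auto simp: ddbump_def Let_def algebra_simps)
  next
    fix i j assume cd: "c = Inr i" "d = Inr j"
    show ?thesis unfolding cd dbump.simps fst_add snd_add fst_scaleR snd_scaleR fst_dirz snd_dirz
        scaleR_zero_right add_0_right
      by (rule DERIV_cong[OF D[OF C DERIV_const R2]]) (auto simp: ddbump_def Let_def algebra_simps)
  qed
qed

lemma continuous_on_bump: "continuous_on S (bump r)"
  unfolding bump_def by (intro continuous_intros)

lemma continuous_on_dbump: "continuous_on S (dbump r c)"
  by (cases c) (auto intro!: continuous_intros)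

lemma continuous_on_ddbump: "continuous_on S (ddbump r c d)"
  unfolding ddbump_def Let_def
  by (cases c; cases d)
    (auto intro!: continuous_intros simp del: of_bool_eq_0_iff)

text \<open>This is the Grushin operator applied to \<open>bump r\<close>;
  \<open>grushin_bump_test\<close> identifies it, up to the time factor.\<close>

definition lbump :: "real \<Rightarrow> ('n::finite, 'k::finite) pt \<Rightarrow> real" where
  "lbump r z = (\<Sum>i\<in>UNIV. ddbump r (Inl i) (Inl i) z)
      + (norm (fst z))\<^sup>2 * (\<Sum>j\<in>UNIV. ddbump r (Inr j) (Inr j) z)"

lemma continuous_on_lbump: "continuous_on S (lbump r)"
  unfolding lbump_def by (intro continuous_intros continuous_on_ddbump)

text \<open>The left-hand side is the Laplacian of the cubed bump in dimension \<open>N\<close> at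
  radius \<open>x\<close>. With \<open>s\<close> the positive part of
  \<open>r\<^sup>2 - x\<^sup>2\<close>, the difference of the two sides is \<open>s\<close> times a
  quadratic in \<open>s\<close>, and the constant is chosen so that its discriminant is
  zero.\<close>

lemma radial_sub_eigenfunction:
  assumes "r > 0" "0 \<le> N"
  shows "24 * x\<^sup>2 * ppow 1 (r\<^sup>2 - x\<^sup>2) - 6 * N * ppow 2 (r\<^sup>2 - x\<^sup>2)
     \<ge> - ((24 + 6 * N)\<^sup>2 / (96 * r\<^sup>2)) * ppow 3 (r\<^sup>2 - x\<^sup>2)"
proof -
  define s where "s = max 0 (r\<^sup>2 - x\<^sup>2)"
  define l where "l = (24 + 6 * N)\<^sup>2 / (96 * r\<^sup>2)"
  have s0: "s \<ge> 0" by (simp add: s_def)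
  \<comment> \<open>Outside the ball both sides vanish with \<open>s\<close>, so the radius can be
    eliminated in favour of \<open>s\<close> everywhere.\<close>
  have xs: "x\<^sup>2 * s = (r\<^sup>2 - s) * s"
    by (auto simp: s_def max_def)
  have "96 * r\<^sup>2 * (l * s\<^sup>2 - (24 + 6 * N) * s + 24 * r\<^sup>2) = ((24 + 6 * N) * s - 48 * r\<^sup>2)\<^sup>2"
    using \<open>r > 0\<close> by (simp add: l_def field_simps power2_eq_square)
  then have "96 * r\<^sup>2 * (l * s\<^sup>2 - (24 + 6 * N) * s + 24 * r\<^sup>2) \<ge> 0" by simp
  then have "l * s\<^sup>2 - (24 + 6 * N) * s + 24 * r\<^sup>2 \<ge> 0"
    using \<open>r > 0\<close> by (simp add: zero_le_mult_iff)
  then have "s * (l * s\<^sup>2 - (24 + 6 * N) * s + 24 * r\<^sup>2) \<ge> 0" using s0 by simp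
  moreover have "s * (l * s\<^sup>2 - (24 + 6 * N) * s + 24 * r\<^sup>2) = 24 * (x\<^sup>2 * s) - 6 * N * s\<^sup>2 + l * s ^ 3"
    unfolding xs by (simp add: algebra_simps power2_eq_square power3_eq_cube)
  ultimately show ?thesis unfolding ppow_def s_def[symmetric] l_def[symmetric] by simp
qed

lemma sum_squares_norm: "(\<Sum>i\<in>UNIV. x $ i * x $ i) = (norm x)\<^sup>2" for x :: "real^'m::finite"
  by (simp add: power2_norm_eq_inner inner_vec_def)

text \<open>Each of the two Laplacians acts on one factor of the product only, so the radial
  estimate applies in dimensions \<open>CARD('n)\<close> and \<open>CARD('k)\<close>, with the other
  factor as a nonnegative multiplier.\<close>

lemma lbump_lower:
  assumes "r > 0"
  obtains L where "L \<ge> 0" "\<And>z :: ('n::finite, 'k::finite) pt. lbump r z \<ge> - L * bump r z"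
proof -
  define f where "f N = (24 + 6 * N)\<^sup>2 / (96 * r\<^sup>2)" for N
  define L where "L = f (real CARD('n)) + r\<^sup>2 * f (real CARD('k))"
  have f0: "f N \<ge> 0" for N by (simp add: f_def)
  show ?thesis
  proof (rule that)
    show "L \<ge> 0" unfolding L_def using f0 by simp
    fix z :: "('n, 'k) pt"
    let ?x = "norm (fst z)" and ?y = "norm (snd z)"
    let ?a = "r\<^sup>2 - ?x\<^sup>2" and ?b = "r\<^sup>2 - ?y\<^sup>2"
    have "lbump r z = (24 * ?x\<^sup>2 * ppow 1 ?a - 6 * real CARD('n) * ppow 2 ?a) * ppow 3 ?b
       + ?x\<^sup>2 * ((24 * ?y\<^sup>2 * ppow 1 ?b - 6 * real CARD('k) * ppow 2 ?b) * ppow 3 ?a)"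
      unfolding lbump_def ddbump_def Let_def
      by (simp add: sum_distrib_right[symmetric] sum_subtractf sum_distrib_left[symmetric]
          mult.assoc[of _ "_ $ _" "_ $ _"] sum_squares_norm del: One_nat_def) (simp add: mult_ac)
    also have "\<dots> \<ge> (- f (real CARD('n)) * ppow 3 ?a) * ppow 3 ?b
       + ?x\<^sup>2 * ((- f (real CARD('k)) * ppow 3 ?b) * ppow 3 ?a)"
      unfolding f_def using assms
      by (intro add_mono mult_right_mono mult_left_mono radial_sub_eigenfunction) auto
    \<comment> \<open>The degenerate weight is unbounded, but where it exceeds
      \<open>r\<^sup>2\<close> the factor depending on \<open>fst z\<close> is zero.\<close>
    moreover have "?x\<^sup>2 * (ppow 3 ?a * (f (real CARD('k)) * ppow 3 ?b)) \<le> r\<^sup>2 * (ppow 3 ?a * (f (real CARD('k)) * ppow 3 ?b))"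
      using f0 by (cases "?x\<^sup>2 \<le> r\<^sup>2") (auto intro!: mult_right_mono simp: ppow_def)
    ultimately show "lbump r z \<ge> - L * bump r z"
      by (simp add: L_def bump_def algebra_simps)
  qed
qed

subsection \<open>Integration over time slabs\<close>

abbreviation slab :: "real \<Rightarrow> ('a \<times> real) set" where
  "slab T \<equiv> UNIV \<times> {0<..<T}"

lemma slab_borel [measurable]: "slab T \<in> sets (borel :: ('a::euclidean_space \<times> real) measure)"
  by (intro borel_open open_Times) auto

text \<open>A constant on the compact set \<open>K \<times> {0..T}\<close> dominates. Only
  measurability and boundedness are asked for, which is what will be known about the memory
  term.\<close>

lemma integrable_slab_bounded:
  fixes f :: "'a::euclidean_space \<times> real \<Rightarrow> real"
  assumes [measurable]: "f \<in> borel_measurable borel" and K: "compact K"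
    and supp: "\<And>w. fst w \<notin> K \<Longrightarrow> f w = 0"
    and bd: "\<And>w. fst w \<in> K \<Longrightarrow> 0 < snd w \<Longrightarrow> snd w < T \<Longrightarrow> \<bar>f w\<bar> \<le> C"
  shows "set_integrable lborel (slab T) f"
proof -
  have KT: "compact (K \<times> {0..T})" using K by (intro compact_Times) auto
  have "integrable lborel (\<lambda>w. indicator (K \<times> {0..T}) w *\<^sub>R \<bar>C\<bar>)"
    using borel_integrable_compact[OF KT, of "\<lambda>_. \<bar>C\<bar>"] by (simp add: set_integrable_def)
  then have "integrable lborel (\<lambda>w. indicator (slab T) w *\<^sub>R f w)"
  proof (rule Bochner_Integration.integrable_bound)
    show "AE w in lborel. norm (indicator (slab T) w *\<^sub>R f w) \<le> norm (indicator (K \<times> {0..T}) w *\<^sub>R \<bar>C\<bar>)"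
      using supp bd by (intro AE_I2) (force simp: indicator_def)
  qed measurable
  then show ?thesis by (simp add: set_integrable_def)
qed

lemma integrable_slab_continuous:
  fixes f :: "'a::euclidean_space \<times> real \<Rightarrow> real"
  assumes f: "continuous_on UNIV f" and K: "compact K"
    and supp: "\<And>w. fst w \<notin> K \<Longrightarrow> f w = 0"
  shows "set_integrable lborel (slab T) f"
proof -
  have KT: "compact (K \<times> {0..T})" using K by (intro compact_Times) auto
  have "compact (f ` (K \<times> {0..T}))"
    by (intro compact_continuous_image KT continuous_on_subset[OF f]) auto
  then obtain C where C: "\<And>w. w \<in> K \<times> {0..T} \<Longrightarrow> \<bar>f w\<bar> \<le> C"
    by (metis compact_imp_bounded bounded_iff image_eqI real_norm_def)
  show ?thesis
    by (rule integrable_slab_bounded[where f = f and C = C, OF _ K supp])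
      (use C f in \<open>auto intro!: borel_measurable_continuous_onI simp: mem_Times_iff\<close>)
qed

lemma DERIV_time_cutoff:
  assumes "T > 0"
  shows "((\<lambda>t. (1 - t / T) ^ Suc n) has_real_derivative - (real (Suc n) / T) * (1 - t / T) ^ n) (at t within S)"
proof -
  have "((\<lambda>t. 1 - t / T) has_real_derivative - 1 / T) (at t within S)"
    using assms by (auto intro!: derivative_eq_intros)
  from DERIV_power[OF this, of "Suc n"] show ?thesis by simp
qed

text \<open>Integration by parts moves the derivative onto the primitive of \<open>f\<close>: the
  exponent of the cutoff rises by one and a factor \<open>T / real (n + 2)\<close> is gained. This
  factor is the source of the growth in \<open>T\<close> that drives the whole argument.\<close>

lemma ibp_cutoff:
  fixes f :: "real \<Rightarrow> real"
  assumes f: "continuous_on UNIV f" and T: "T > 0"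
  shows "(LINT t:{0<..<T}|lborel. (LINT s:{0..t}|lborel. f s) * (1 - t / T) ^ Suc n)
    = T / real (n + 2) * (LINT t:{0<..<T}|lborel. f t * (1 - t / T) ^ (n + 2))"
proof -
  define H where "H t = integral {0..t} f" for t
  have H: "(LINT s:{0..t}|lborel. f s) = H t" for t
    unfolding H_def
    by (rule set_borel_integral_eq_integral) (intro borel_integrable_atLeastAtMost' continuous_on_subset[OF f], auto)
  have dH: "(H has_real_derivative f t) (at t within {0..T})" if "t \<in> {0..T}" for t
    unfolding H_def by (rule integral_has_real_derivative) (use that f continuous_on_subset in auto)
  have cH: "continuous_on {0..T} H"
    using dH by (meson DERIV_continuous continuous_on_eq_continuous_within)
  have cf: "continuous_on {0..T} f" by (rule continuous_on_subset[OF f]) auto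
  let ?P = "\<lambda>t. H t * (1 - t / T) ^ Suc n" and ?Q = "\<lambda>t. T / real (n + 2) * (f t * (1 - t / T) ^ (n + 2))"
  let ?G = "\<lambda>t. - (T / real (n + 2)) * (H t * (1 - t / T) ^ (n + 2))"
  have cP: "continuous_on {0..T} ?P" and cQ: "continuous_on {0..T} ?Q"
    using T by (auto intro!: continuous_intros cH cf)
  note iP = borel_integrable_atLeastAtMost'[OF cP] and iQ = borel_integrable_atLeastAtMost'[OF cQ]
  have "(LINT t:{0..T}|lborel. ?P t - ?Q t) = ?G T - ?G 0"
    unfolding set_lebesgue_integral_def
  proof (rule integral_FTC_atLeastAtMost)
    fix t assume t: "0 \<le> t" "t \<le> T"
    have d1: "((\<lambda>t. (1 - t / T) ^ (n + 2)) has_real_derivative - (real (n + 2) / T) * (1 - t / T) ^ Suc n) (at t within {0..T})"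
      using DERIV_time_cutoff[OF T, of "Suc n"] by simp
    have "(?G has_real_derivative ?P t - ?Q t) (at t within {0..T})"
    proof (rule DERIV_cong[OF DERIV_cmult[OF DERIV_mult[OF dH d1]]])
      have "- (T / m) * (a * p + - (m / T) * q * h) = h * q - T / m * (a * p)" if "m > 0" for m a p q h
        using that T by (simp add: field_simps)
      then show "- (T / real (n + 2)) * (f t * (1 - t / T) ^ (n + 2) + - (real (n + 2) / T) * (1 - t / T) ^ Suc n * H t) = ?P t - ?Q t"
        by simp
    qed (use t in auto)
    then show "(?G has_vector_derivative ?P t - ?Q t) (at t within {0..T})"
      by (simp add: has_real_derivative_iff_has_vector_derivative)
  qed (use T cP cQ in \<open>auto intro!: continuous_on_diff\<close>)
  \<comment> \<open>Both boundary terms vanish: the cutoff is 0 at time \<open>T\<close>, and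
    \<open>H\<close> is 0 at time 0.\<close>
  also have "\<dots> = 0" using T by (simp add: H_def)
  also have "(LINT t:{0..T}|lborel. ?P t - ?Q t) = (LINT t:{0..T}|lborel. ?P t) - (LINT t:{0..T}|lborel. ?Q t)"
    by (rule set_integral_diff[OF iP iQ])
  finally have eq: "(LINT t:{0..T}|lborel. ?P t) = (LINT t:{0..T}|lborel. ?Q t)" by simp
  \<comment> \<open>The fundamental theorem of calculus lives on the closed interval, the weak
    formulation on the open one; the endpoints are a null set.\<close>
  have open_closed: "(LINT t:{0<..<T}|lborel. g t) = (LINT t:{0..T}|lborel. g t)"
    if "set_integrable lborel {0..T} g" for g :: "real \<Rightarrow> real"
  proof (rule set_integral_cong_set)
    show B: "set_borel_measurable lborel {0..T} g"
      using that borel_measurable_integrable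
      unfolding set_integrable_def set_borel_measurable_def by blast
    show "set_borel_measurable lborel {0<..<T} g"
      by (rule set_borel_measurable_subset[OF B]) auto
    have "AE x in lborel. x \<noteq> 0 \<and> x \<noteq> T" by (intro AE_conjI AE_lborel_singleton)
    then show "AE x in lborel. (x \<in> {0..T}) = (x \<in> {0<..<T})" by eventually_elim auto
  qed
  show ?thesis
    unfolding H open_closed[OF iP] eq open_closed[OF iQ, symmetric] by simp
qed

subsection \<open>The test functions\<close>

text \<open>The exponent \<open>Suc n\<close> forces the value 0 at time \<open>T\<close> and leaves
  the power \<open>n\<close> after one time derivative, while integration by parts in the memory
  term produces the power \<open>n + 2\<close>.\<close>

definition bump_test :: "real \<Rightarrow> real \<Rightarrow> nat \<Rightarrow> ('n::finite, 'k::finite) pt \<Rightarrow> real \<Rightarrow> real" where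
  "bump_test r T n z t = bump r z * (1 - t / T) ^ Suc n"

lemma pdz_bump_test: "pdz c (bump_test r T n) = (\<lambda>z t. dbump r c z * (1 - t / T) ^ Suc n)"
  unfolding pdz_def bump_test_def
  by (intro ext DERIV_imp_deriv DERIV_cmult_right DERIV_bump_line)

lemma pdz_pdz_bump_test:
  "pdz d (pdz c (bump_test r T n)) = (\<lambda>z t. ddbump r c d z * (1 - t / T) ^ Suc n)"
  unfolding pdz_bump_test unfolding pdz_def
  by (intro ext DERIV_imp_deriv DERIV_cmult_right DERIV_dbump_line)

lemma grushin_bump_test: "grushin (bump_test r T n) z t = lbump r z * (1 - t / T) ^ Suc n"
  unfolding grushin_def pdz_pdz_bump_test lbump_def
  by (simp add: sum_distrib_right[symmetric] distrib_right mult.assoc del: power_Suc)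

lemma DERIV_bump_test:
  assumes "T > 0"
  shows "((\<lambda>s. bump_test r T n z s) has_real_derivative
    bump r z * (- (real (Suc n) / T) * (1 - t / T) ^ n)) (at t within S)"
  unfolding bump_test_def by (intro DERIV_cmult DERIV_time_cutoff assms)

lemma pdt_bump_test:
  assumes "T > 0" "t \<in> {0..T}"
  shows "pdt T (bump_test r T n) z t = bump r z * (- (real (Suc n) / T) * (1 - t / T) ^ n)"
  unfolding pdt_def
  by (rule vector_derivative_within_closed_interval[OF assms
      DERIV_bump_test[OF assms(1), unfolded has_real_derivative_iff_has_vector_derivative]])

lemma ppow_radius_eq_0: "ppow (Suc n) (r\<^sup>2 - (norm x)\<^sup>2) = 0" if "norm x > \<bar>r\<bar>"
  using that abs_le_square_iff[of "norm x" r] by (simp add: ppow_def max_def)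

lemma ppow_radius_eq_0':
  assumes "norm x > \<bar>r\<bar>"
  shows "ppow 1 (r\<^sup>2 - (norm x)\<^sup>2) = 0" "ppow 2 (r\<^sup>2 - (norm x)\<^sup>2) = 0" "ppow 3 (r\<^sup>2 - (norm x)\<^sup>2) = 0"
  using ppow_radius_eq_0[OF assms, of 0] ppow_radius_eq_0[OF assms, of 1] ppow_radius_eq_0[OF assms, of 2]
  by (simp_all add: eval_nat_numeral)

lemma outside_cylinder:
  assumes "z \<notin> cball 0 \<bar>r\<bar> \<times> cball 0 \<bar>r\<bar>"
  obtains "norm (fst z) > \<bar>r\<bar>" | "norm (snd z) > \<bar>r\<bar>"
  using assms by (cases z) (auto simp: not_le)

lemma bump_outside: "z \<notin> cball 0 \<bar>r\<bar> \<times> cball 0 \<bar>r\<bar> \<Longrightarrow> bump r z = 0"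
  by (erule outside_cylinder) (simp_all add: bump_def ppow_radius_eq_0')

lemma lbump_outside: "z \<notin> cball 0 \<bar>r\<bar> \<times> cball 0 \<bar>r\<bar> \<Longrightarrow> lbump r z = 0"
  by (erule outside_cylinder) (simp_all add: lbump_def ddbump_def ppow_radius_eq_0' del: One_nat_def)

lemma bump_nonneg [simp]: "bump r z \<ge> 0"
  by (simp add: bump_def)

lemma bump_pos:
  assumes "norm (fst z) < r" "norm (snd z) < r"
  shows "bump r z > 0"
proof -
  have "(norm (fst z))\<^sup>2 < r\<^sup>2" "(norm (snd z))\<^sup>2 < r\<^sup>2"
    using assms by (auto intro!: power_strict_mono)
  then show ?thesis by (simp add: bump_def ppow_def)
qed

lemma test_fun_bump_test:
  assumes "T > 0"
  shows "test_fun T (bump_test r T n :: ('n::finite, 'k::finite) pt \<Rightarrow> real \<Rightarrow> real)"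
proof -
  have c: "continuous_on S (\<lambda>w :: ('n, 'k) pt \<times> real. f (fst w) * (1 - snd w / T) ^ m)"
    if "continuous_on UNIV f" for f :: "('n, 'k) pt \<Rightarrow> real" and m S
  proof (rule continuous_on_mult)
    show "continuous_on S (\<lambda>w. f (fst w))"
      by (rule continuous_on_compose2[OF that continuous_on_fst[OF continuous_on_id]]) auto
    show "continuous_on S (\<lambda>w :: ('n, 'k) pt \<times> real. (1 - snd w / T) ^ m)"
      using assms by (auto intro!: continuous_intros)
  qed
  have "C21_on T (bump_test r T n :: ('n, 'k) pt \<Rightarrow> real \<Rightarrow> real)"
    unfolding C21_on_def
  proof (intro conjI allI impI)
    show "continuous_on (UNIV \<times> {0..T}) (\<lambda>w::('n, 'k) pt \<times> real. bump_test r T n (fst w) (snd w))"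
      unfolding bump_test_def by (intro c continuous_on_bump)
    show "continuous_on (UNIV \<times> {0..T}) (\<lambda>w::('n, 'k) pt \<times> real. pdz x (bump_test r T n) (fst w) (snd w))" for x
      unfolding pdz_bump_test by (intro c continuous_on_dbump)
    show "continuous_on (UNIV \<times> {0..T}) (\<lambda>w::('n, 'k) pt \<times> real. pdz y (pdz x (bump_test r T n)) (fst w) (snd w))" for x y
      unfolding pdz_pdz_bump_test by (intro c continuous_on_ddbump)
    show "((\<lambda>h. bump_test r T n (z + h *\<^sub>R dirz x) t) has_real_derivative pdz x (bump_test r T n) z t) (at 0)"
      for x and z :: "('n, 'k) pt" and t
      unfolding pdz_bump_test unfolding bump_test_def by (intro DERIV_cmult_right DERIV_bump_line)
    show "((\<lambda>h. pdz x (bump_test r T n) (z + h *\<^sub>R dirz y) t) has_real_derivative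
        pdz y (pdz x (bump_test r T n)) z t) (at 0)" for x y and z :: "('n, 'k) pt" and t
      unfolding pdz_pdz_bump_test unfolding pdz_bump_test by (intro DERIV_cmult_right DERIV_dbump_line)
    show "((\<lambda>s. bump_test r T n z s) has_real_derivative pdt T (bump_test r T n) z t) (at t within {0..T})"
      if "t \<in> {0..T}" for z :: "('n, 'k) pt" and t
      unfolding pdt_bump_test[OF assms that] by (rule DERIV_bump_test[OF assms])
    \<comment> \<open>The formula for \<open>pdt\<close> is available on \<open>{0..T}\<close> only,
      so continuity is shown for the closed form and then transferred to this set.\<close>
    have "continuous_on (UNIV \<times> {0..T})
        (\<lambda>w::('n, 'k) pt \<times> real. - (real (Suc n) / T) * (bump r (fst w) * (1 - snd w / T) ^ n))"
      by (intro continuous_on_mult_left c continuous_on_bump)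
    then show "continuous_on (UNIV \<times> {0..T}) (\<lambda>w::('n, 'k) pt \<times> real. pdt T (bump_test r T n) (fst w) (snd w))"
      by (rule continuous_on_eq) (auto simp: pdt_bump_test[OF assms])
  qed
  moreover have "compact_supp_on T (bump_test r T n :: ('n, 'k) pt \<Rightarrow> real \<Rightarrow> real)"
    unfolding compact_supp_on_def
  proof (intro exI conjI allI impI)
    show "compact (cball 0 \<bar>r\<bar> \<times> cball 0 \<bar>r\<bar> :: ('n, 'k) pt set)"
      by (intro compact_Times compact_cball)
    show "z \<in> cball 0 \<bar>r\<bar> \<times> cball 0 \<bar>r\<bar>" if "t \<in> {0..T} \<and> bump_test r T n z t \<noteq> 0"
      for z :: "('n, 'k) pt" and t
      using that bump_outside[of z r] unfolding bump_test_def by (metis mult_zero_left)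
  qed
  ultimately show ?thesis
    using assms by (simp add: test_fun_def bump_test_def)
qed

subsection \<open>The memory term\<close>

text \<open>The reflection of \<open>s\<close> to \<open>t - s\<close> turns the kernel into a power
  with its singularity at 0, integrable because \<open>\<gamma> < 1\<close>.\<close>

lemma singular_kernel:
  fixes \<gamma> t :: real
  assumes "\<gamma> < 1" "t \<ge> 0"
  shows "set_integrable lborel {0..t} (\<lambda>s. (t - s) powr (- \<gamma>))"
    and "(LINT s:{0..t}|lborel. (t - s) powr (- \<gamma>)) = t powr (1 - \<gamma>) / (1 - \<gamma>)"
proof -
  let ?f = "\<lambda>s. indicator {0..t} s *\<^sub>R s powr (- \<gamma>)"
  have hi: "((\<lambda>s. s powr (- \<gamma>)) has_integral (t powr (1 - \<gamma>) / (1 - \<gamma>))) {0..t}"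
    using has_integral_powr_from_0[of "- \<gamma>" t] assms by simp
  then have "(\<lambda>s. s powr (- \<gamma>)) absolutely_integrable_on {0..t}"
    by (intro nonnegative_absolutely_integrable_1) auto
  then have "integrable lebesgue ?f"
    by (simp add: set_integrable_def)
  then have int: "integrable lborel ?f"
    by (subst (asm) integrable_completion) auto
  have flip: "?f (t + - 1 * s) = indicator {0..t} s *\<^sub>R (t - s) powr (- \<gamma>)" for s
    by (auto simp: indicator_def)
  show "set_integrable lborel {0..t} (\<lambda>s. (t - s) powr (- \<gamma>))"
    using lborel_integrable_real_affine[OF int, of "- 1" t] unfolding flip set_integrable_def by simp
  have "(LINT s:{0..t}|lborel. (t - s) powr (- \<gamma>)) = (\<integral>s. ?f s \<partial>lborel)"
    using lborel_integral_real_affine[of "- 1" ?f t] unfolding flip set_lebesgue_integral_def by simp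
  also have "\<dots> = t powr (1 - \<gamma>) / (1 - \<gamma>)"
    using set_borel_integral_eq_integral(2)[of "{0..t}" "\<lambda>s. s powr (- \<gamma>)"] int integral_unique[OF hi]
    unfolding set_integrable_def set_lebesgue_integral_def by simp
  finally show "(LINT s:{0..t}|lborel. (t - s) powr (- \<gamma>)) = t powr (1 - \<gamma>) / (1 - \<gamma>)" .
qed

lemma spow_nonneg_eq: "v \<ge> 0 \<Longrightarrow> spow p v = v powr p"
  by (cases "v = 0") (auto simp: spow_def powr_diff)

text \<open>Memory at time \<open>t\<close> depends on the past in \<open>{0..t}\<close> only, so
  the values given to a function at negative times are immaterial.\<close>

lemma memory_cong: "(\<And>s. 0 \<le> s \<Longrightarrow> s \<le> t \<Longrightarrow> u z s = v z s) \<Longrightarrow> memory \<gamma> p u z t = memory \<gamma> p v z t"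
  unfolding memory_def by (intro set_lebesgue_integral_cong) auto

lemma memory_integrable:
  fixes f :: "real \<Rightarrow> real"
  assumes "\<gamma> < 1" "p > 0" "t \<ge> 0" "t \<le> T"
    and cont: "continuous_on UNIV f" and f: "\<And>s. 0 \<le> s \<Longrightarrow> s \<le> T \<Longrightarrow> 0 \<le> f s \<and> f s \<le> M"
  shows "set_integrable lborel {0..t} (\<lambda>s. (t - s) powr (- \<gamma>) * spow p (f s))"
proof -
  have [measurable]: "f \<in> borel_measurable borel"
    using cont by (rule borel_measurable_continuous_onI)
  have "integrable lborel (\<lambda>s. M powr p * (indicator {0..t} s *\<^sub>R (t - s) powr (- \<gamma>)))"
    using singular_kernel(1)[of \<gamma> t] assms unfolding set_integrable_def by (intro integrable_mult_right) auto
  then show ?thesis unfolding set_integrable_def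
  proof (rule Bochner_Integration.integrable_bound)
    have "\<bar>indicator {0..t} s * ((t - s) powr - \<gamma> * spow p (f s))\<bar>
        \<le> \<bar>M powr p * (indicator {0..t} s * (t - s) powr - \<gamma>)\<bar>" for s
    proof (cases "s \<in> {0..t}")
      case True
      then have "0 \<le> f s" "f s \<le> M" using f[of s] assms by auto
      then have "(t - s) powr - \<gamma> * f s powr p \<le> (t - s) powr - \<gamma> * M powr p"
        using assms by (intro mult_left_mono powr_mono2) auto
      then show ?thesis using True \<open>0 \<le> f s\<close> by (simp add: spow_nonneg_eq mult.commute)
    qed simp
    then show "AE s in lborel. norm (indicator {0..t} s *\<^sub>R ((t - s) powr - \<gamma> * spow p (f s)))
         \<le> norm (M powr p * (indicator {0..t} s *\<^sub>R (t - s) powr - \<gamma>))"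
      by simp
  qed (unfold spow_def, measurable)
qed

text \<open>The first two bounds serve integrability over a slab. The third carries the argument:
  \<open>t - s \<le> T\<close> and \<open>\<gamma> \<ge> 0\<close> bound the kernel below by
  \<open>T powr (- \<gamma>)\<close>, which replaces the singular convolution by a plain
  primitive.\<close>

lemma memory_bounds:
  fixes v :: "('n::finite, 'k::finite) pt \<Rightarrow> real \<Rightarrow> real"
  assumes "\<gamma> < 1" "0 \<le> \<gamma>" "p > 0" "0 \<le> t" "t \<le> T"
    and cont: "continuous_on UNIV (v z)" and v: "\<And>s. 0 \<le> s \<Longrightarrow> s \<le> T \<Longrightarrow> 0 \<le> v z s \<and> v z s \<le> M"
  shows "0 \<le> memory \<gamma> p v z t"
    and "memory \<gamma> p v z t \<le> M powr p * (T powr (1 - \<gamma>) / (1 - \<gamma>))"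
    and "T powr (- \<gamma>) * (LINT s:{0..t}|lborel. v z s powr p) \<le> memory \<gamma> p v z t"
proof -
  note int = memory_integrable[of \<gamma> p t T "v z" M, OF assms(1,3-7)]
  note K = singular_kernel[of \<gamma> t, OF assms(1,4)]
  show "0 \<le> memory \<gamma> p v z t"
    unfolding memory_def set_lebesgue_integral_def using v assms(5)
    by (intro Bochner_Integration.integral_nonneg) (simp add: indicator_def spow_nonneg_eq)
  have "memory \<gamma> p v z t \<le> (LINT s:{0..t}|lborel. M powr p * (t - s) powr (- \<gamma>))"
    unfolding memory_def
  proof (rule set_integral_mono[OF int set_integrable_mult_right[OF K(1)]])
    fix s assume "s \<in> {0..t}"
    then have "0 \<le> v z s" "v z s \<le> M" using v[of s] assms(5) by auto
    then have "(t - s) powr (- \<gamma>) * v z s powr p \<le> (t - s) powr (- \<gamma>) * M powr p"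
      using assms(3) by (intro mult_left_mono powr_mono2) auto
    then show "(t - s) powr (- \<gamma>) * spow p (v z s) \<le> M powr p * (t - s) powr (- \<gamma>)"
      using \<open>0 \<le> v z s\<close> by (simp add: spow_nonneg_eq mult.commute)
  qed
  also have "\<dots> = M powr p * (t powr (1 - \<gamma>) / (1 - \<gamma>))" using K(2) by simp
  also have "\<dots> \<le> M powr p * (T powr (1 - \<gamma>) / (1 - \<gamma>))"
    using assms by (intro mult_left_mono divide_right_mono powr_mono2) auto
  finally show "memory \<gamma> p v z t \<le> M powr p * (T powr (1 - \<gamma>) / (1 - \<gamma>))" .
  have int': "set_integrable lborel {0..t} (\<lambda>s. v z s powr p)"
    by (rule borel_integrable_atLeastAtMost'[OF continuous_on_powr'[OF continuous_on_subset[OF cont] continuous_on_const]])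
      (use v assms(3-5) in auto)
  \<comment> \<open>At \<open>s = t\<close> the convention \<open>0 powr a = 0\<close> makes the
    kernel vanish, and its lower bound would fail there.\<close>
  have "AE s in lborel. s \<noteq> t" by (rule AE_lborel_singleton)
  then have "AE s \<in> {0..t} in lborel. T powr (- \<gamma>) * v z s powr p \<le> (t - s) powr (- \<gamma>) * spow p (v z s)"
  proof eventually_elim
    case (elim s)
    have "T powr (- \<gamma>) \<le> (t - s) powr (- \<gamma>)" if "s \<in> {0..t}"
      using that elim assms by (intro powr_mono2') auto
    then show ?case using v[of s] assms(5) by (simp add: spow_nonneg_eq mult_right_mono)
  qed
  then have "(LINT s:{0..t}|lborel. T powr (- \<gamma>) * v z s powr p) \<le> memory \<gamma> p v z t"
    unfolding memory_def by (intro set_integral_mono_AE set_integrable_mult_right int int')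
  then show "T powr (- \<gamma>) * (LINT s:{0..t}|lborel. v z s powr p) \<le> memory \<gamma> p v z t" by simp
qed

text \<open>The moving domain \<open>{0..snd w}\<close> becomes the indicator of a closed set in the
  product space. The integrand is then jointly measurable, and so is its integral as a function of
  the parameter.\<close>

lemma convolution_measurable:
  fixes f :: "'a::euclidean_space \<Rightarrow> real \<Rightarrow> real" and k :: "real \<Rightarrow> real"
  assumes f: "continuous_on UNIV (\<lambda>w. f (fst w) (snd w))" and [measurable]: "k \<in> borel_measurable borel"
    and [measurable]: "g \<in> borel_measurable borel"
  shows "(\<lambda>w. LINT s:{0..snd w}|lborel. k (snd w - s) * g (f (fst w) s)) \<in> borel_measurable borel"
proof -
  have [measurable]: "(\<lambda>(w :: 'a \<times> real, s). f (fst w) s) \<in> borel_measurable (borel \<Otimes>\<^sub>M borel)"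
    unfolding borel_prod
    using continuous_on_compose2[OF f, of UNIV "\<lambda>x. (fst (fst x), snd x)"]
    by (intro borel_measurable_continuous_onI) (simp add: case_prod_unfold continuous_intros)
  have [measurable]: "{w :: ('a \<times> real) \<times> real. 0 \<le> snd w \<and> snd w \<le> snd (fst w)} \<in> sets (borel \<Otimes>\<^sub>M borel)"
    unfolding borel_prod
    by (intro borel_closed closed_Collect_conj closed_Collect_le continuous_intros)
  have [measurable]: "(\<lambda>w :: ('a \<times> real) \<times> real. snd (fst w) - snd w) \<in> borel_measurable (borel \<Otimes>\<^sub>M borel)"
    unfolding borel_prod by (intro borel_measurable_continuous_onI continuous_intros)
  have "(\<lambda>(w :: 'a \<times> real, s). indicator {w :: ('a \<times> real) \<times> real. 0 \<le> snd w \<and> snd w \<le> snd (fst w)} (w, s)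
      * (k (snd (fst (w, s)) - snd (w, s)) * g (f (fst w) s))) \<in> borel_measurable (borel \<Otimes>\<^sub>M lborel)"
    by measurable
  from lborel.borel_measurable_lebesgue_integral[OF this]
  have "(\<lambda>w. \<integral>s. indicator {w :: ('a \<times> real) \<times> real. 0 \<le> snd w \<and> snd w \<le> snd (fst w)} (w, s)
      * (k (snd (fst (w, s)) - snd (w, s)) * g (f (fst w) s)) \<partial>lborel) \<in> borel_measurable borel" .
  moreover have "(\<lambda>w. \<integral>s. indicator {w :: ('a \<times> real) \<times> real. 0 \<le> snd w \<and> snd w \<le> snd (fst w)} (w, s)
      * (k (snd (fst (w, s)) - snd (w, s)) * g (f (fst w) s)) \<partial>lborel)
     = (\<lambda>w. LINT s:{0..snd w}|lborel. k (snd w - s) * g (f (fst w) s))"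
    unfolding set_lebesgue_integral_def
    by (intro ext Bochner_Integration.integral_cong) (auto simp: indicator_def)
  ultimately show ?thesis by (simp only:)
qed

section \<open>Fubini on slabs, integration by parts in time, and joint continuity\<close>

lemma slab_Fubini:
  fixes F :: "'a::euclidean_space \<times> real \<Rightarrow> real"
  assumes "set_integrable lborel (slab T) F"
  shows "(LINT w:slab T|lborel. F w) = (LINT z|lborel. (LINT t:{0<..<T}|lborel. F (z, t)))"
proof -
  have "integrable (lborel \<Otimes>\<^sub>M lborel) (\<lambda>(z, t). indicator {0<..<T} t *\<^sub>R F (z, t))"
    using assms unfolding set_integrable_def lborel_prod
    by (rule Bochner_Integration.integrable_cong[THEN iffD1, rotated -1]) (auto simp: indicator_def)
  from lborel_pair.integral_fst'[OF this]
  have "(LINT z|lborel. (LINT t:{0<..<T}|lborel. F (z, t)))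
      = (\<integral>w. (case w of (z, t) \<Rightarrow> indicator {0<..<T} t *\<^sub>R F (z, t)) \<partial>(lborel \<Otimes>\<^sub>M lborel))"
    unfolding set_lebesgue_integral_def by simp
  also have "\<dots> = (LINT w:slab T|lborel. F w)"
    unfolding set_lebesgue_integral_def lborel_prod
    by (intro Bochner_Integration.integral_cong) (auto simp: indicator_def)
  finally show ?thesis ..
qed

lemma continuous_on_partial:
  assumes "continuous_on UNIV (\<lambda>w. f (fst w) (snd w))"
  shows "continuous_on S (f z)"
  using continuous_on_compose2[OF assms continuous_on_Pair[OF continuous_on_const[of S z] continuous_on_id]]
  by simp

lemma bounded_on_compact_slab:
  fixes f :: "'a::euclidean_space \<Rightarrow> real \<Rightarrow> real"
  assumes "continuous_on UNIV (\<lambda>w. f (fst w) (snd w))" "compact K"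
  obtains M where "\<And>z t. z \<in> K \<Longrightarrow> 0 \<le> t \<Longrightarrow> t \<le> T \<Longrightarrow> \<bar>f z t\<bar> \<le> M"
proof -
  have "compact ((\<lambda>w. f (fst w) (snd w)) ` (K \<times> {0..T}))"
    by (intro compact_continuous_image compact_Times assms compact_Icc continuous_on_subset[OF assms(1)]) auto
  then obtain M where M: "\<forall>y \<in> (\<lambda>w. f (fst w) (snd w)) ` (K \<times> {0..T}). \<bar>y\<bar> \<le> M"
    by (auto dest!: compact_imp_bounded simp: bounded_iff)
  show ?thesis
    by (rule that[of M]) (use M in force)
qed

text \<open>Fubini reduces the identity to \<open>ibp_cutoff\<close> at each fixed point
  \<open>z\<close>, with \<open>\<psi> z\<close> as a constant factor. Integrability comes from the
  bound of the primitive by \<open>M * T\<close> over \<open>K\<close>.\<close>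

lemma ibp_cutoff_slab:
  fixes f :: "'a::euclidean_space \<Rightarrow> real \<Rightarrow> real"
  assumes f: "continuous_on UNIV (\<lambda>w. f (fst w) (snd w))"
    and \<psi>: "continuous_on UNIV \<psi>" and K: "compact K" and supp: "\<And>z. z \<notin> K \<Longrightarrow> \<psi> z = 0"
    and T: "T > 0"
  shows "set_integrable lborel (slab T)
      (\<lambda>w. (LINT s:{0..snd w}|lborel. f (fst w) s) * (\<psi> (fst w) * (1 - snd w / T) ^ Suc n))" (is "set_integrable _ _ ?L")
    and "(LINT w:slab T|lborel. (LINT s:{0..snd w}|lborel. f (fst w) s) * (\<psi> (fst w) * (1 - snd w / T) ^ Suc n))
      = T / real (n + 2) * (LINT w:slab T|lborel. f (fst w) (snd w) * (\<psi> (fst w) * (1 - snd w / T) ^ (n + 2)))"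
      (is "_ = _ * (LINT w:_|_. ?R w)")
proof -
  have c\<psi>: "continuous_on UNIV (\<lambda>w :: 'a \<times> real. \<psi> (fst w))"
    by (rule continuous_on_compose2[OF \<psi> continuous_on_fst[OF continuous_on_id]]) auto
  have cw: "continuous_on UNIV (\<lambda>w :: 'a \<times> real. (1 - snd w / T) ^ m)" for m
    using T by (auto intro!: continuous_intros)
  obtain M where M: "\<And>z t. z \<in> K \<Longrightarrow> 0 \<le> t \<Longrightarrow> t \<le> T \<Longrightarrow> \<bar>f z t\<bar> \<le> M"
    using bounded_on_compact_slab[where f = f, OF f K] by blast
  obtain M' where M': "\<And>z t. z \<in> K \<Longrightarrow> 0 \<le> t \<Longrightarrow> t \<le> T \<Longrightarrow> \<bar>\<psi> z * (1 - t / T) ^ Suc n\<bar> \<le> M'"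
    using bounded_on_compact_slab[where f = "\<lambda>z t. \<psi> z * (1 - t / T) ^ Suc n", OF _ K]
      continuous_on_mult[OF c\<psi> cw[of "Suc n"]] by blast
  show iL: "set_integrable lborel (slab T) ?L"
  proof (rule integrable_slab_bounded[OF _ K])
    show "?L \<in> borel_measurable borel"
    proof (rule borel_measurable_times)
      show "(\<lambda>w. LINT s:{0..snd w}|lborel. f (fst w) s) \<in> borel_measurable borel"
        using convolution_measurable[where f = f and k = "\<lambda>_. 1" and g = "\<lambda>x. x",
            OF f borel_measurable_const measurable_ident_sets[OF refl]]
        by (simp only: mult_1)
      show "(\<lambda>w :: 'a \<times> real. \<psi> (fst w) * (1 - snd w / T) ^ Suc n) \<in> borel_measurable borel"
        by (rule borel_measurable_continuous_onI[OF continuous_on_mult[OF c\<psi> cw]])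
    qed
    show "?L w = 0" if "fst w \<notin> K" for w using supp[OF that] by simp
    fix w assume w: "fst w \<in> K" "0 < snd w" "snd w < T"
    have i: "set_integrable lborel {0..snd w} (f (fst w))"
      by (rule borel_integrable_atLeastAtMost'[OF continuous_on_partial[where f = f, OF f]])
    have "\<bar>LINT s:{0..snd w}|lborel. f (fst w) s\<bar> = norm (integral {0..snd w} (f (fst w)))"
      using set_borel_integral_eq_integral(2)[OF i] by simp
    also have "\<dots> \<le> M * (snd w - 0)"
    proof (rule integral_bound)
      show "norm (f (fst w) t) \<le> M" if "t \<in> {0..snd w}" for t
        using that M[of "fst w" t] w by simp
      show "continuous_on {0..snd w} (f (fst w))" by (rule continuous_on_partial[where f = f, OF f])
    qed (use w in simp)
    \<comment> \<open>The bound at time 0 is invoked only to know that \<open>M\<close> is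
      nonnegative.\<close>
    also have "\<dots> \<le> M * T"
      using w M[of "fst w" 0] T by (intro mult_left_mono) auto
    finally show "\<bar>?L w\<bar> \<le> (M * T) * M'"
      using M'[of "fst w" "snd w"] w
      unfolding abs_mult[of _ "_ * _"] by (intro mult_mono) (auto intro: order_trans[OF abs_ge_zero])
  qed
  have iR: "set_integrable lborel (slab T) ?R"
    by (rule integrable_slab_continuous[OF continuous_on_mult[OF f continuous_on_mult[OF c\<psi> cw]] K])
      (simp add: supp)
  have "(LINT w:slab T|lborel. ?L w) = (LINT z|lborel. (LINT t:{0<..<T}|lborel. ?L (z, t)))"
    by (rule slab_Fubini[OF iL])
  also have "\<dots> = (LINT z|lborel. T / real (n + 2) * (LINT t:{0<..<T}|lborel. ?R (z, t)))"
  proof (rule Bochner_Integration.integral_cong[OF refl])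
    show "(LINT t:{0<..<T}|lborel. ?L (z, t)) = T / real (n + 2) * (LINT t:{0<..<T}|lborel. ?R (z, t))" for z
    proof -
      have "(LINT t:{0<..<T}|lborel. ?L (z, t))
          = (LINT t:{0<..<T}|lborel. \<psi> z * ((LINT s:{0..t}|lborel. f z s) * (1 - t / T) ^ Suc n))"
        unfolding fst_conv snd_conv by (simp only: mult.left_commute)
      also have "\<dots> = \<psi> z * (T / real (n + 2) * (LINT t:{0<..<T}|lborel. f z t * (1 - t / T) ^ (n + 2)))"
        unfolding set_integral_mult_right by (simp only: ibp_cutoff[OF continuous_on_partial[where f = f, OF f] T])
      also have "\<dots> = T / real (n + 2) * (LINT t:{0<..<T}|lborel. \<psi> z * (f z t * (1 - t / T) ^ (n + 2)))"
        unfolding set_integral_mult_right by (rule mult.left_commute)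
      also have "\<dots> = T / real (n + 2) * (LINT t:{0<..<T}|lborel. ?R (z, t))"
        unfolding fst_conv snd_conv by (simp only: mult.left_commute)
      finally show ?thesis .
    qed
  qed
  also have "\<dots> = T / real (n + 2) * (LINT z|lborel. (LINT t:{0<..<T}|lborel. ?R (z, t)))"
    by simp
  also have "(LINT z|lborel. (LINT t:{0<..<T}|lborel. ?R (z, t))) = (LINT w:slab T|lborel. ?R w)"
    by (rule slab_Fubini[OF iR, symmetric])
  finally show "(LINT w:slab T|lborel. ?L w) = T / real (n + 2) * (LINT w:slab T|lborel. ?R w)" .
qed

text \<open>Continuity in time is uniform in space, so it combines with continuity in space at the
  fixed time \<open>t0\<close>. Freezing the function at its initial value for negative times gives
  continuity on the whole space.\<close>

lemma C_C0_continuous: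
  fixes u :: "('n::finite, 'k::finite) pt \<Rightarrow> real \<Rightarrow> real"
  assumes "C_C0 u"
  shows "continuous_on UNIV (\<lambda>w. u (fst w) (max 0 (snd w)))"
  unfolding continuous_on_iff
proof (intro ballI allI impI)
  fix w0 :: "('n, 'k) pt \<times> real" and e :: real
  assume e: "e > 0"
  define t0 where "t0 = max 0 (snd w0)"
  have t0: "t0 \<ge> 0" by (simp add: t0_def)
  have "continuous_on UNIV (\<lambda>z. u z t0)"
    using assms t0 by (auto simp: C_C0_def C0_def)
  then obtain d1 where d1: "d1 > 0" "\<And>z. dist z (fst w0) < d1 \<Longrightarrow> dist (u z t0) (u (fst w0) t0) < e / 2"
    using e unfolding continuous_on_iff by (metis UNIV_I half_gt_zero)
  obtain d2 where d2: "d2 > 0" "\<And>s z. s \<ge> 0 \<Longrightarrow> \<bar>s - t0\<bar> < d2 \<Longrightarrow> \<bar>u z s - u z t0\<bar> < e / 2"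
    using assms t0 e unfolding C_C0_def by (metis half_gt_zero)
  show "\<exists>d>0. \<forall>w\<in>UNIV. dist w w0 < d \<longrightarrow> dist (u (fst w) (max 0 (snd w))) (u (fst w0) (max 0 (snd w0))) < e"
  proof (intro exI[of _ "min d1 d2"] conjI ballI impI)
    fix w assume w: "dist w w0 < min d1 d2"
    have "\<bar>max 0 (snd w) - t0\<bar> \<le> dist (snd w) (snd w0)" by (auto simp: t0_def dist_real_def)
    also have "\<dots> < d2" using w dist_snd_le[of w w0] by simp
    finally have "\<bar>u (fst w) (max 0 (snd w)) - u (fst w) t0\<bar> < e / 2" by (intro d2) auto
    moreover have "dist (u (fst w) t0) (u (fst w0) t0) < e / 2"
      using w dist_fst_le[of w w0] by (intro d1) simp
    ultimately show "dist (u (fst w) (max 0 (snd w))) (u (fst w0) (max 0 (snd w0))) < e"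
      unfolding t0_def[symmetric] dist_real_def by linarith
  qed (use d1 d2 in auto)
qed

subsection \<open>The inequality obtained from the weak formulation\<close>

text \<open>The weak formulation is tested with \<open>bump_test r T n\<close>, and each of the four
  terms on its right-hand side is bounded below separately in \<open>I1\<close> to
  \<open>I4\<close>.\<close>

lemma weak_solution_cutoff_ineq:
  fixes u :: "('n::finite, 'k::finite) pt \<Rightarrow> real \<Rightarrow> real" and L :: real
  assumes \<gamma>: "0 \<le> \<gamma>" "\<gamma> < 1" and p1: "p1 > 1" and T: "T \<ge> 1"
    and u: "C_C0 u" "\<And>z t. t \<ge> 0 \<Longrightarrow> u z t \<ge> 0" and sol: "weak_solution \<gamma> p1 p2 u0 T u"
    and L: "L \<ge> 0" "\<And>z :: ('n, 'k) pt. lbump r z \<ge> - L * bump r z"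
  defines "v \<equiv> \<lambda>z t. u z (max 0 t)"
  shows "(LINT z|lborel. u0 z * bump r z)
      + T powr (1 - \<gamma>) / real (n + 2)
          * (LINT w:slab T|lborel. v (fst w) (snd w) powr p1 * (bump r (fst w) * (1 - snd w / T) ^ (n + 2)))
    \<le> (L + Suc n) * (LINT w:slab T|lborel. v (fst w) (snd w) * (bump r (fst w) * (1 - snd w / T) ^ n))"
proof -
  let ?\<phi> = "bump_test r T n :: ('n, 'k) pt \<Rightarrow> real \<Rightarrow> real"
  let ?w = "\<lambda>x :: ('n, 'k) pt \<times> real. 1 - snd x / T"
  define K :: "('n, 'k) pt set" where "K = cball 0 \<bar>r\<bar> \<times> cball 0 \<bar>r\<bar>"
  have K: "compact K" unfolding K_def by (intro compact_Times compact_cball)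
  have T0: "T > 0" using T by simp
  have p0: "p1 > 0" using p1 by simp
  have v_nonneg: "v z t \<ge> 0" for z t unfolding v_def by (rule u) simp
  have uv: "u z t = v z t" if "t \<ge> 0" for z t using that by (simp add: v_def)
  have cv: "continuous_on UNIV (\<lambda>x. v (fst x) (snd x))"
    unfolding v_def by (rule C_C0_continuous[OF u(1)])
  have cvp: "continuous_on UNIV (\<lambda>x. v (fst x) (snd x) powr p1)"
    by (rule continuous_on_powr'[OF cv continuous_on_const]) (use v_nonneg p1 in auto)
  have cb: "continuous_on UNIV (\<lambda>x :: ('n, 'k) pt \<times> real. bump r (fst x))"
    by (rule continuous_on_compose2[OF continuous_on_bump continuous_on_fst[OF continuous_on_id]]) auto
  have clb: "continuous_on UNIV (\<lambda>x :: ('n, 'k) pt \<times> real. lbump r (fst x))"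
    by (rule continuous_on_compose2[OF continuous_on_lbump continuous_on_fst[OF continuous_on_id]]) auto
  have cw: "continuous_on UNIV (\<lambda>x. ?w x ^ m)" for m
    using T0 by (auto intro!: continuous_intros)
  have b0: "bump r z = 0" if "z \<notin> K" for z :: "('n, 'k) pt"
    using that bump_outside unfolding K_def by blast
  have lb0: "lbump r z = 0" if "z \<notin> K" for z :: "('n, 'k) pt"
    using that lbump_outside unfolding K_def by blast
  have w01: "0 \<le> ?w x \<and> ?w x \<le> 1" if "x \<in> slab T" for x
    using that T0 by (auto simp: field_simps)
  have wn: "?w x ^ Suc n \<le> ?w x ^ n" if "x \<in> slab T" for x
    using w01[OF that] by (intro power_decreasing) auto
  let ?Q = "\<lambda>x. v (fst x) (snd x) * (bump r (fst x) * ?w x ^ n)"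
  have iQ: "set_integrable lborel (slab T) ?Q"
    by (rule integrable_slab_continuous[OF continuous_on_mult[OF cv continuous_on_mult[OF cb cw]] K])
      (simp add: b0)

  have I1: "T powr (1 - \<gamma>) / real (n + 2)
        * (LINT x:slab T|lborel. v (fst x) (snd x) powr p1 * (bump r (fst x) * ?w x ^ (n + 2)))
      \<le> (LINT x:slab T|lborel. memory \<gamma> p1 u (fst x) (snd x) * ?\<phi> (fst x) (snd x))"
  proof -
    have iH: "set_integrable lborel (slab T)
        (\<lambda>x. (LINT s:{0..snd x}|lborel. v (fst x) s powr p1) * (bump r (fst x) * ?w x ^ Suc n))"
      by (rule ibp_cutoff_slab(1)[where f = "\<lambda>z t. v z t powr p1" and \<psi> = "bump r"])
        (fact cvp continuous_on_bump K b0 T0)+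
    have ibp: "(LINT x:slab T|lborel.
          (LINT s:{0..snd x}|lborel. v (fst x) s powr p1) * (bump r (fst x) * ?w x ^ Suc n))
        = T / real (n + 2) * (LINT x:slab T|lborel. v (fst x) (snd x) powr p1 * (bump r (fst x) * ?w x ^ (n + 2)))"
      by (rule ibp_cutoff_slab(2)[where f = "\<lambda>z t. v z t powr p1" and \<psi> = "bump r"])
        (fact cvp continuous_on_bump K b0 T0)+
    obtain M where M: "\<And>z t. z \<in> K \<Longrightarrow> 0 \<le> t \<Longrightarrow> t \<le> T \<Longrightarrow> \<bar>v z t\<bar> \<le> M"
      using bounded_on_compact_slab[where f = v, OF cv K] by blast
    have mem_eq: "memory \<gamma> p1 u z t = memory \<gamma> p1 v z t" for z t
      by (intro memory_cong uv)
    have mb: "0 \<le> memory \<gamma> p1 v z t"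
        "memory \<gamma> p1 v z t \<le> M powr p1 * (T powr (1 - \<gamma>) / (1 - \<gamma>))"
        "T powr (- \<gamma>) * (LINT s:{0..t}|lborel. v z s powr p1) \<le> memory \<gamma> p1 v z t"
      if "z \<in> K" "0 \<le> t" "t \<le> T" for z t
    proof -
      have vM: "0 \<le> v z s \<and> v z s \<le> M" if "0 \<le> s" "s \<le> T" for s
        using M[OF \<open>z \<in> K\<close> that] v_nonneg by (simp add: abs_le_iff)
      note cvz = continuous_on_partial[where f = v, OF cv]
      show "0 \<le> memory \<gamma> p1 v z t"
        by (rule memory_bounds(1)[where T = T and M = M]) (fact \<gamma> p0 that cvz vM)+
      show "memory \<gamma> p1 v z t \<le> M powr p1 * (T powr (1 - \<gamma>) / (1 - \<gamma>))"
        by (rule memory_bounds(2)) (fact \<gamma> p0 that cvz vM)+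
      show "T powr (- \<gamma>) * (LINT s:{0..t}|lborel. v z s powr p1) \<le> memory \<gamma> p1 v z t"
        by (rule memory_bounds(3)[where M = M]) (fact \<gamma> p0 that cvz vM)+
    qed
    have memory_measurable: "(\<lambda>x. memory \<gamma> p1 v (fst x) (snd x)) \<in> borel_measurable borel"
    proof -
      have "(\<lambda>r. r powr (- \<gamma>)) \<in> borel_measurable borel" "spow p1 \<in> borel_measurable borel"
        unfolding spow_def by measurable
      then show ?thesis unfolding memory_def by (rule convolution_measurable[where f = v, OF cv])
    qed
    have im: "set_integrable lborel (slab T) (\<lambda>x. memory \<gamma> p1 v (fst x) (snd x) * (bump r (fst x) * ?w x ^ Suc n))"
    proof -
      obtain M' where M': "\<And>z t. z \<in> K \<Longrightarrow> 0 \<le> t \<Longrightarrow> t \<le> T \<Longrightarrow> \<bar>bump r z * (1 - t / T) ^ Suc n\<bar> \<le> M'"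
        using bounded_on_compact_slab[where f = "\<lambda>z t. bump r z * (1 - t / T) ^ Suc n", OF _ K]
          continuous_on_mult[OF cb cw[of "Suc n"]] by blast
      show ?thesis
      proof (rule integrable_slab_bounded[OF _ K])
        show "(\<lambda>x. memory \<gamma> p1 v (fst x) (snd x) * (bump r (fst x) * ?w x ^ Suc n)) \<in> borel_measurable borel"
          by (rule borel_measurable_times[OF memory_measurable borel_measurable_continuous_onI[OF continuous_on_mult[OF cb cw]]])
        fix x :: "('n, 'k) pt \<times> real" assume x: "fst x \<in> K" "0 < snd x" "snd x < T"
        show "\<bar>memory \<gamma> p1 v (fst x) (snd x) * (bump r (fst x) * ?w x ^ Suc n)\<bar>
            \<le> (M powr p1 * (T powr (1 - \<gamma>) / (1 - \<gamma>))) * M'"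
          unfolding abs_mult[of _ "_ * _"] using M'[of "fst x" "snd x"] mb[of "fst x" "snd x"] x
          by (intro mult_mono) auto
      qed (simp add: b0)
    qed
    \<comment> \<open>The factor \<open>T powr (- \<gamma>)\<close> comes from the kernel bound, the
      factor \<open>T\<close> from integration by parts.\<close>
    have "T powr (1 - \<gamma>) = T powr (- \<gamma>) * T"
      using T0 powr_add[of T "- \<gamma>" 1] by simp
    then have "T powr (1 - \<gamma>) / real (n + 2)
        * (LINT x:slab T|lborel. v (fst x) (snd x) powr p1 * (bump r (fst x) * ?w x ^ (n + 2)))
      = T powr (- \<gamma>) * (LINT x:slab T|lborel.
            (LINT s:{0..snd x}|lborel. v (fst x) s powr p1) * (bump r (fst x) * ?w x ^ Suc n))"
      unfolding ibp by (simp only: times_divide_eq_left times_divide_eq_right mult.assoc)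
    also have "\<dots> = (LINT x:slab T|lborel. T powr (- \<gamma>) *
            ((LINT s:{0..snd x}|lborel. v (fst x) s powr p1) * (bump r (fst x) * ?w x ^ Suc n)))"
      by (rule set_integral_mult_right[symmetric])
    also have "\<dots> \<le> (LINT x:slab T|lborel. memory \<gamma> p1 v (fst x) (snd x) * (bump r (fst x) * ?w x ^ Suc n))"
    proof (rule set_integral_mono[OF set_integrable_mult_right[OF iH] im])
      fix x :: "('n, 'k) pt \<times> real" assume x: "x \<in> slab T"
      show "T powr (- \<gamma>) * ((LINT s:{0..snd x}|lborel. v (fst x) s powr p1) * (bump r (fst x) * ?w x ^ Suc n))
          \<le> memory \<gamma> p1 v (fst x) (snd x) * (bump r (fst x) * ?w x ^ Suc n)"
      proof (cases "fst x \<in> K")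
        case True
        have "T powr (- \<gamma>) * (LINT s:{0..snd x}|lborel. v (fst x) s powr p1) \<le> memory \<gamma> p1 v (fst x) (snd x)"
          using x by (intro mb True) auto
        then show ?thesis
          unfolding mult.assoc[symmetric, of "T powr (- \<gamma>)"]
          using w01[OF x] by (intro mult_right_mono mult_nonneg_nonneg) auto
      qed (simp add: b0)
    qed
    finally show ?thesis unfolding mem_eq bump_test_def .
  qed

  have I2: "0 \<le> (LINT x:slab T|lborel. spow p2 (u (fst x) (snd x)) * ?\<phi> (fst x) (snd x))"
    unfolding set_lebesgue_integral_def
  proof (rule Bochner_Integration.integral_nonneg)
    show "0 \<le> indicator (slab T) x *\<^sub>R (spow p2 (u (fst x) (snd x)) * ?\<phi> (fst x) (snd x))" for x
      using w01[of x] v_nonneg[of "fst x" "snd x"] uv[of "snd x" "fst x"]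
      by (cases "x \<in> slab T") (auto simp: bump_test_def spow_nonneg_eq intro!: mult_nonneg_nonneg)
  qed

  have I3: "- L * (LINT x:slab T|lborel. ?Q x)
      \<le> (LINT x:slab T|lborel. u (fst x) (snd x) * grushin ?\<phi> (fst x) (snd x))"
  proof -
    have "- L * (LINT x:slab T|lborel. ?Q x) = (LINT x:slab T|lborel. - L * ?Q x)"
      by (rule set_integral_mult_right[symmetric])
    also have "\<dots> \<le> (LINT x:slab T|lborel. v (fst x) (snd x) * (lbump r (fst x) * ?w x ^ Suc n))"
    proof (rule set_integral_mono[OF set_integrable_mult_right[OF iQ]])
      show "set_integrable lborel (slab T) (\<lambda>x. v (fst x) (snd x) * (lbump r (fst x) * ?w x ^ Suc n))"
        by (rule integrable_slab_continuous[OF continuous_on_mult[OF cv continuous_on_mult[OF clb cw]] K])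
          (simp add: lb0)
      fix x :: "('n, 'k) pt \<times> real" assume x: "x \<in> slab T"
      \<comment> \<open>The cutoff lies between 0 and 1, and the coefficient is nonpositive, so
        lowering the exponent lowers the product. The Grushin term thus acquires the same power
        \<open>n\<close> as the time derivative.\<close>
      have "- (L * bump r (fst x)) * ?w x ^ n \<le> - (L * bump r (fst x)) * ?w x ^ Suc n"
        using wn[OF x] L(1) by (intro mult_left_mono_neg) auto
      also have "\<dots> \<le> lbump r (fst x) * ?w x ^ Suc n"
        using L(2)[of "fst x"] w01[OF x] by (intro mult_right_mono zero_le_power) auto
      finally have "v (fst x) (snd x) * (- (L * bump r (fst x)) * ?w x ^ n)
          \<le> v (fst x) (snd x) * (lbump r (fst x) * ?w x ^ Suc n)"
        by (intro mult_left_mono v_nonneg)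
      then show "- L * ?Q x \<le> v (fst x) (snd x) * (lbump r (fst x) * ?w x ^ Suc n)"
        by (simp add: mult_ac del: power_Suc)
    qed
    also have "\<dots> = (LINT x:slab T|lborel. u (fst x) (snd x) * grushin ?\<phi> (fst x) (snd x))"
      by (rule set_lebesgue_integral_cong) (auto simp: grushin_bump_test uv)
    finally show ?thesis .
  qed

  have I4: "- real (Suc n) * (LINT x:slab T|lborel. ?Q x)
      \<le> (LINT x:slab T|lborel. u (fst x) (snd x) * pdt T ?\<phi> (fst x) (snd x))"
  proof -
    have "(LINT x:slab T|lborel. u (fst x) (snd x) * pdt T ?\<phi> (fst x) (snd x))
        = (LINT x:slab T|lborel. - (real (Suc n) / T) * ?Q x)"
      by (rule set_lebesgue_integral_cong) (auto simp: pdt_bump_test[OF T0] uv)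
    also have "\<dots> = - (real (Suc n) / T) * (LINT x:slab T|lborel. ?Q x)"
      by (rule set_integral_mult_right)
    finally have eq: "(LINT x:slab T|lborel. u (fst x) (snd x) * pdt T ?\<phi> (fst x) (snd x))
        = - (real (Suc n) / T) * (LINT x:slab T|lborel. ?Q x)" .
    have "(LINT x:slab T|lborel. ?Q x) \<ge> 0"
      unfolding set_lebesgue_integral_def
    proof (rule Bochner_Integration.integral_nonneg)
      show "0 \<le> indicator (slab T) x *\<^sub>R ?Q x" for x
        using w01[of x] v_nonneg by (cases "x \<in> slab T") auto
    qed
    \<comment> \<open>Here \<open>T \<ge> 1\<close> makes the constant independent of
      \<open>T\<close>.\<close>
    moreover have "real (Suc n) / T \<le> real (Suc n)"
      using T divide_left_mono[of 1 T "real (Suc n)"] by simp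
    ultimately show ?thesis unfolding eq by (intro mult_right_mono) auto
  qed

  have "- (LINT z|lborel. u0 z * ?\<phi> z 0)
      = (LINT x:slab T|lborel. memory \<gamma> p1 u (fst x) (snd x) * ?\<phi> (fst x) (snd x))
      + (LINT x:slab T|lborel. spow p2 (u (fst x) (snd x)) * ?\<phi> (fst x) (snd x))
      + (LINT x:slab T|lborel. u (fst x) (snd x) * grushin ?\<phi> (fst x) (snd x))
      + (LINT x:slab T|lborel. u (fst x) (snd x) * pdt T ?\<phi> (fst x) (snd x))"
    using sol test_fun_bump_test[OF T0, of r n] unfolding weak_solution_def by blast
  moreover have "?\<phi> z 0 = bump r z" for z by (simp add: bump_test_def)
  moreover have "c + X \<le> (L + s) * q"
    if "- c = a + b + d + e" "X \<le> a" "0 \<le> b" "- L * q \<le> d" "- s * q \<le> e" for a b c d e q s X :: real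
    using that by (simp add: algebra_simps)
  ultimately show ?thesis
    using I1 I2 I3 I4 by (simp only:)
qed

subsection \<open>Absorption and the critical case\<close>

text \<open>A threshold argument replaces the usual inequality for conjugate exponents. Above
  \<open>\<theta>\<close> the superlinear term already dominates; below it the left-hand side is at
  most a constant, because \<open>n\<close> is large enough to compensate the negative power of
  \<open>w\<close>.\<close>

lemma weighted_young:
  fixes x w S p :: real
  assumes "x \<ge> 0" "0 < w" "w \<le> 1" "S > 0" "p > 1" "2 / (p - 1) \<le> real n"
  shows "x * w ^ n \<le> S * (x powr p * w ^ (n + 2)) + S powr (- (1 / (p - 1)))"
proof -
  define q where "q = 1 / (p - 1)"
  \<comment> \<open>This is the solution of
    \<open>S * w\<^sup>2 * \<theta> powr (p - 1) = 1\<close>, the point where both powers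
    balance.\<close>
  define \<theta> where "\<theta> = (S * w\<^sup>2) powr (- q)"
  have \<theta>: "\<theta> > 0" using assms by (simp add: \<theta>_def)
  show ?thesis
  proof (cases "x \<le> \<theta>")
    case True
    have "x * w ^ n \<le> \<theta> * w ^ n" using True assms by (intro mult_right_mono) auto
    also have "\<dots> = S powr (- q) * w powr (real n - 2 * q)"
    proof -
      have "\<theta> = S powr (- q) * w powr (- 2 * q)"
        using assms by (simp add: \<theta>_def powr_mult powr_powr flip: powr_numeral)
      moreover have "w ^ n = w powr n" using assms by (simp add: powr_realpow)
      ultimately show ?thesis by (simp add: mult.assoc flip: powr_add)
    qed
    \<comment> \<open>The hypothesis on \<open>n\<close> says exactly that the exponent
      \<open>real n - 2 * q\<close> is nonnegative.\<close>
    also have "\<dots> \<le> S powr (- q) * 1"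
      using assms by (intro mult_left_mono powr_le1) (auto simp: q_def)
    finally show ?thesis using assms by (simp add: q_def add_increasing)
  next
    case False
    have "- q * (p - 1) = - 1" using assms by (simp add: q_def)
    then have "\<theta> powr (p - 1) = inverse (S * w\<^sup>2)"
      using assms unfolding \<theta>_def powr_powr by (simp add: powr_minus)
    then have "1 = S * w\<^sup>2 * \<theta> powr (p - 1)"
      using assms by (simp add: field_simps)
    also have "\<dots> \<le> S * w\<^sup>2 * x powr (p - 1)"
      using False \<theta> assms by (intro mult_left_mono powr_mono2) auto
    finally have "x * w ^ n * 1 \<le> x * w ^ n * (S * w\<^sup>2 * x powr (p - 1))"
      using assms by (intro mult_left_mono) auto
    also have "\<dots> = S * ((x * x powr (p - 1)) * w ^ (n + 2))"
      by (simp add: power_add power2_eq_square mult_ac)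
    also have "x * x powr (p - 1) = x powr p"
      using False \<theta> by (simp add: powr_mult_base)
    finally show ?thesis by (simp add: add_increasing2)
  qed
qed

lemma le_0_if_le_powr_neg:
  fixes a b q :: real
  assumes "q > 0" and "\<And>B. B > 0 \<Longrightarrow> a \<le> b * B powr (- q)"
  shows "a \<le> 0"
proof (rule tendsto_lowerbound)
  have "((\<lambda>B::real. B powr (- q)) \<longlongrightarrow> 0) at_top"
    using assms(1) by (intro tendsto_neg_powr filterlim_ident) auto
  then show "((\<lambda>B::real. b * B powr (- q)) \<longlongrightarrow> 0) at_top"
    by (rule tendsto_mult_right_zero)
  show "\<forall>\<^sub>F B in at_top. a \<le> b * B powr (- q)"
    using eventually_gt_at_top[of 0] by eventually_elim (rule assms(2))
qed simp

text \<open>The limiting argument is isolated from the integrals. \<open>E\<close> stands for the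
  energy up to time \<open>T\<close>, \<open>Y\<close> for its version with cutoff, \<open>Q\<close>
  for the linear integral, and \<open>G\<close> for the cost of the initial period up to
  \<open>A\<close>. First \<open>Q1\<close> bounds \<open>E\<close>; then \<open>Q2\<close>, where
  only the tail \<open>E T - E A\<close> is multiplied by \<open>B\<close>, shows that its supremum
  is not positive.\<close>

lemma absorption:
  fixes E Y Q G :: "real \<Rightarrow> real" and \<alpha> q L k m c \<Psi> :: real
  assumes pos: "\<alpha> > 0" "q > 0" "L > 0" "k > 0" "m > 0" "c \<ge> 0"
    and E_mono: "\<And>s t. 1 \<le> s \<Longrightarrow> s \<le> t \<Longrightarrow> E s \<le> E t"
    and Y_nonneg: "\<And>T. T \<ge> 1 \<Longrightarrow> Y T \<ge> 0"
    and Y_le: "\<And>T. T \<ge> 1 \<Longrightarrow> Y T \<le> E T" and Y_ge: "\<And>T. T \<ge> 2 \<Longrightarrow> k * E (T / 2) \<le> Y T"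
    and H: "\<And>T. T \<ge> 1 \<Longrightarrow> c + T powr \<alpha> / m * Y T \<le> L * Q T"
    and Q1: "\<And>T B. T \<ge> 1 \<Longrightarrow> B > 0 \<Longrightarrow> Q T \<le> T powr \<alpha> * (B * Y T + B powr (- q) * \<Psi>)"
    and Q2: "\<And>A T B. 1 \<le> A \<Longrightarrow> A \<le> T \<Longrightarrow> B > 0 \<Longrightarrow>
        Q T \<le> G A + T powr \<alpha> * (B * (E T - E A) + B powr (- q) * \<Psi>)"
  shows "c \<le> 0"
proof -
  \<comment> \<open>With this choice \<open>L * B0\<close> is half of \<open>1 / m\<close>, so half
    of the left-hand side survives the absorption.\<close>
  define B0 where "B0 = 1 / (2 * L * m)"
  have B0: "B0 > 0" using pos by (simp add: B0_def)
  define C where "C = 2 * m * (L * (B0 powr (- q) * \<Psi>)) / k"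
  have E_bd: "E T \<le> C" if "T \<ge> 1" for T
  proof -
    \<comment> \<open>The inequality is used at \<open>2 * T\<close> because the cutoff integral
      there controls the full energy up to \<open>T\<close>.\<close>
    have T2: "2 * T \<ge> 1" "2 * T \<ge> 2" using that by auto
    have "(2 * T) powr \<alpha> * (Y (2 * T) / m) \<le> L * Q (2 * T)"
      using H[OF T2(1)] pos by simp
    also have "\<dots> \<le> L * ((2 * T) powr \<alpha> * (B0 * Y (2 * T) + B0 powr (- q) * \<Psi>))"
      using Q1[OF T2(1) B0] pos by (intro mult_left_mono) auto
    also have "\<dots> = (2 * T) powr \<alpha> * (L * B0 * Y (2 * T) + L * (B0 powr (- q) * \<Psi>))"
      by (simp add: algebra_simps)
    finally have "Y (2 * T) / m \<le> L * B0 * Y (2 * T) + L * (B0 powr (- q) * \<Psi>)"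
      using that by (subst (asm) mult_le_cancel_left_pos) auto
    moreover have "L * B0 * Y (2 * T) = Y (2 * T) / (2 * m)"
      using pos by (simp add: B0_def)
    ultimately have "Y (2 * T) / (2 * m) \<le> L * (B0 powr (- q) * \<Psi>)" by (simp add: field_simps)
    then have "Y (2 * T) \<le> 2 * m * (L * (B0 powr (- q) * \<Psi>))"
      using pos by (simp add: field_simps)
    moreover have "k * E T \<le> Y (2 * T)" using Y_ge[OF T2(2)] by simp
    ultimately show ?thesis using pos by (simp add: C_def field_simps)
  qed
  define S where "S = (SUP T\<in>{1..}. E T)"
  have bdd: "bdd_above (E ` {1..})" using E_bd by (intro bdd_aboveI2) auto
  have E_le_S: "E T \<le> S" if "T \<ge> 1" for T
    unfolding S_def by (intro cSUP_upper bdd) (use that in auto)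
  have near: "\<exists>A\<ge>1. S - \<epsilon> < E A" if "\<epsilon> > 0" for \<epsilon>
    using less_cSUP_iff[OF _ bdd, of "S - \<epsilon>"] that unfolding S_def[symmetric] by auto
  have S_eps: "k / m * (S - \<epsilon>) \<le> L * (B * \<epsilon> + B powr (- q) * \<Psi>)" if B: "B > 0" and \<epsilon>: "\<epsilon> > 0" for B \<epsilon>
  proof -
    from near[OF \<epsilon>] obtain A where A: "A \<ge> 1" "S - \<epsilon> < E A" by auto
    \<comment> \<open>For \<open>T \<ge> 2 * A\<close> the energy at \<open>T / 2\<close> exceeds
      \<open>S - \<epsilon>\<close>, while the tail beyond \<open>A\<close> is below
      \<open>\<epsilon>\<close>. After division by \<open>T powr \<alpha>\<close> the cost
      \<open>G A\<close> disappears as \<open>T\<close> grows with \<open>A\<close> fixed.\<close>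
    have "k / m * (S - \<epsilon>) \<le> L * (G A * T powr (- \<alpha>)) + L * (B * \<epsilon> + B powr (- q) * \<Psi>)"
      if T: "T \<ge> 2 * A" for T
    proof -
      have T': "T \<ge> 1" "T \<ge> 2" "T \<ge> A" "T / 2 \<ge> A" "T / 2 \<ge> 1" using A T by auto
      have Tp: "T powr \<alpha> > 0" using T' by simp
      have "T powr \<alpha> * (k / m * (S - \<epsilon>)) \<le> T powr \<alpha> * (k / m * E (T / 2))"
        using E_mono[OF A(1) T'(4)] A pos by (intro mult_left_mono) auto
      also have "\<dots> = T powr \<alpha> / m * (k * E (T / 2))" by simp
      also have "\<dots> \<le> T powr \<alpha> / m * Y T"
        using Y_ge[OF T'(2)] pos by (intro mult_left_mono) auto
      also have "\<dots> \<le> L * Q T" using H[OF T'(1)] pos by simp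
      also have "\<dots> \<le> L * (G A + T powr \<alpha> * (B * (E T - E A) + B powr (- q) * \<Psi>))"
        using Q2[OF A(1) T'(3) B] pos by (intro mult_left_mono) auto
      also have "\<dots> \<le> L * (G A + T powr \<alpha> * (B * \<epsilon> + B powr (- q) * \<Psi>))"
        using E_le_S[OF T'(1)] A pos B by (intro mult_left_mono add_mono) auto
      also have "\<dots> = T powr \<alpha> * (L * (G A * T powr (- \<alpha>)) + L * (B * \<epsilon> + B powr (- q) * \<Psi>))"
        using T' by (simp add: powr_minus field_simps)
      finally show ?thesis using Tp by (subst (asm) mult_le_cancel_left_pos) auto
    qed
    then have "\<forall>\<^sub>F T in at_top. k / m * (S - \<epsilon>) \<le> L * (G A * T powr (- \<alpha>)) + L * (B * \<epsilon> + B powr (- q) * \<Psi>)"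
      using eventually_ge_at_top[of "2 * A"] by (rule eventually_mono[rotated])
    moreover have "((\<lambda>T. L * (G A * T powr (- \<alpha>)) + L * (B * \<epsilon> + B powr (- q) * \<Psi>))
        \<longlongrightarrow> L * (G A * 0) + L * (B * \<epsilon> + B powr (- q) * \<Psi>)) at_top"
      using pos by (intro tendsto_intros tendsto_neg_powr filterlim_ident) auto
    ultimately have "k / m * (S - \<epsilon>) \<le> L * (G A * 0) + L * (B * \<epsilon> + B powr (- q) * \<Psi>)"
      by (intro tendsto_lowerbound[OF _ _ trivial_limit_at_top_linorder])
    then show ?thesis by simp
  qed
  \<comment> \<open>Letting \<open>\<epsilon>\<close> tend to 0 at fixed \<open>B\<close> removes
    \<open>B * \<epsilon>\<close>. Only then may \<open>B\<close> grow.\<close>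
  have "k / m * S \<le> L * \<Psi> * B powr (- q)" if B: "B > 0" for B
  proof (rule tendsto_le[of "at_right 0"])
    show "\<forall>\<^sub>F \<epsilon> in at_right 0. k / m * (S - \<epsilon>) \<le> L * (B * \<epsilon> + B powr (- q) * \<Psi>)"
      using eventually_at_right_less[of 0] by eventually_elim (rule S_eps[OF B])
    show "((\<lambda>\<epsilon>. k / m * (S - \<epsilon>)) \<longlongrightarrow> k / m * S) (at_right 0)"
      by (rule tendsto_eq_intros refl | simp)+
    show "((\<lambda>\<epsilon>. L * (B * \<epsilon> + B powr (- q) * \<Psi>)) \<longlongrightarrow> L * \<Psi> * B powr (- q)) (at_right 0)"
      by (rule tendsto_eq_intros refl | simp)+
  qed simp
  from le_0_if_le_powr_neg[OF pos(2) this] have S0: "S \<le> 0"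
    using pos by (simp add: mult_le_0_iff divide_le_0_iff)
  \<comment> \<open>This follows from \<open>0 \<le> Y 1 \<le> E 1 \<le> S \<le> 0\<close>. At time
    1 the bound \<open>Q1\<close> is thereby reduced to the part that decays in
    \<open>B\<close>.\<close>
  have Y1: "Y 1 = 0" using Y_le[of 1] E_le_S[of 1] S0 Y_nonneg[of 1] by simp
  have "c \<le> L * \<Psi> * B powr (- q)" if "B > 0" for B
  proof -
    have "Q 1 \<le> \<Psi> * B powr (- q)" using Q1[of 1 B] that Y1 by (simp add: mult.commute)
    then have "L * Q 1 \<le> L * (\<Psi> * B powr (- q))" using pos by (intro mult_left_mono) auto
    then show ?thesis using H[of 1] Y1 by simp
  qed
  from le_0_if_le_powr_neg[OF pos(2) this] show ?thesis .
qed

section \<open>Verification of the absorption hypotheses for integrals over slabs\<close>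

lemma integral_slab_const_in_time:
  fixes \<psi> :: "'a::euclidean_space \<Rightarrow> real"
  assumes "continuous_on UNIV \<psi>" "compact K" "\<And>z. z \<notin> K \<Longrightarrow> \<psi> z = 0" "T \<ge> 0"
  shows "(LINT w:slab T|lborel. \<psi> (fst w)) = T * (LINT z|lborel. \<psi> z)"
proof -
  have "continuous_on UNIV (\<lambda>w :: 'a \<times> real. \<psi> (fst w))"
    by (rule continuous_on_compose2[OF assms(1) continuous_on_fst[OF continuous_on_id]]) auto
  then have "set_integrable lborel (slab T) (\<lambda>w. \<psi> (fst w))"
    by (rule integrable_slab_continuous[OF _ assms(2)]) (simp add: assms(3))
  from slab_Fubini[OF this] show ?thesis
    using assms(4) by (simp add: set_lebesgue_integral_def)
qed

text \<open>Integrals over slabs of different lengths are put on a common domain, where integrands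
  can be compared pointwise.\<close>

lemma slab_indicator_integral:
  fixes f :: "'a::euclidean_space \<times> real \<Rightarrow> real"
  assumes "A \<le> T"
  shows "(LINT w:slab T|lborel. indicator (slab A) w * f w) = (LINT w:slab A|lborel. f w)"
  unfolding set_lebesgue_integral_def
  by (rule Bochner_Integration.integral_cong) (use assms in \<open>auto simp: indicator_def\<close>)

lemma slab_indicator_integrable:
  fixes f :: "'a::euclidean_space \<times> real \<Rightarrow> real"
  assumes "set_integrable lborel (slab T) f"
  shows "set_integrable lborel (slab T) (\<lambda>w. indicator (slab A) w * f w)"
  using assms integrable_real_mult_indicator[of "slab A" lborel "\<lambda>w. indicator (slab T) w * f w"]
  by (simp add: set_integrable_def mult_ac)

text \<open>The integrals in \<open>H\<close> are fed into \<open>absorption\<close> with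
  \<open>\<alpha> = 1 - \<gamma>\<close>. Its bounds on \<open>Q\<close> are the pointwise estimate
  \<open>young\<close> integrated over the slab, on all of it for the first and beyond time
  \<open>A\<close> for the second.\<close>

lemma cutoff_inequality_imp_nonpos:
  fixes v :: "'a::euclidean_space \<Rightarrow> real \<Rightarrow> real" and \<gamma> p c L :: real
  assumes \<gamma>: "0 \<le> \<gamma>" "\<gamma> < 1" and p: "p > 1" "p * \<gamma> \<le> 1" and n: "2 / (p - 1) \<le> real n"
    and L: "L > 0" and c: "c \<ge> 0"
    and v: "continuous_on UNIV (\<lambda>w. v (fst w) (snd w))" "\<And>z t. v z t \<ge> 0"
    and \<psi>: "continuous_on UNIV \<psi>" "\<And>z. \<psi> z \<ge> 0"
    and K: "compact K" and supp: "\<And>z. z \<notin> K \<Longrightarrow> \<psi> z = 0"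
    and H: "\<And>T. T \<ge> 1 \<Longrightarrow> c + T powr (1 - \<gamma>) / real (n + 2)
          * (LINT w:slab T|lborel. v (fst w) (snd w) powr p * (\<psi> (fst w) * (1 - snd w / T) ^ (n + 2)))
        \<le> L * (LINT w:slab T|lborel. v (fst w) (snd w) * (\<psi> (fst w) * (1 - snd w / T) ^ n))"
  shows "c \<le> 0"
proof -
  define f where "f w = v (fst w) (snd w) powr p * \<psi> (fst w)" for w
  define g where "g w = v (fst w) (snd w) * \<psi> (fst w)" for w
  define y where "y T w = v (fst w) (snd w) powr p * (\<psi> (fst w) * (1 - snd w / T) ^ (n + 2))" for T w
  define h where "h T w = v (fst w) (snd w) * (\<psi> (fst w) * (1 - snd w / T) ^ n)" for T w
  define E where "E T = (LINT w:slab T|lborel. f w)" for T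
  define Y where "Y T = (LINT w:slab T|lborel. y T w)" for T
  define Q where "Q T = (LINT w:slab T|lborel. h T w)" for T
  define G where "G T = (LINT w:slab T|lborel. g w)" for T
  define \<Psi> where "\<Psi> = (LINT z|lborel. \<psi> z)"
  define q where "q = 1 / (p - 1)"
  have c\<psi>: "continuous_on UNIV (\<lambda>w :: 'a \<times> real. \<psi> (fst w))"
    by (rule continuous_on_compose2[OF \<psi>(1) continuous_on_fst[OF continuous_on_id]]) auto
  have cvp: "continuous_on UNIV (\<lambda>w. v (fst w) (snd w) powr p)"
    by (rule continuous_on_powr'[OF v(1) continuous_on_const]) (use v(2) p in auto)
  have cw: "continuous_on UNIV (\<lambda>w :: 'a \<times> real. (1 - snd w / T) ^ m)" if "T > 0" for m T
    using that by (auto intro!: continuous_intros)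
  have i\<psi>: "set_integrable lborel (slab T) (\<lambda>w. \<psi> (fst w))" for T
    by (rule integrable_slab_continuous[OF c\<psi> K]) (simp add: supp)
  have if': "set_integrable lborel (slab T) f" for T
    unfolding f_def by (rule integrable_slab_continuous[OF continuous_on_mult[OF cvp c\<psi>] K]) (simp add: supp)
  have ig: "set_integrable lborel (slab T) g" for T
    unfolding g_def by (rule integrable_slab_continuous[OF continuous_on_mult[OF v(1) c\<psi>] K]) (simp add: supp)
  have iy: "set_integrable lborel (slab S) (y T)" if "T > 0" for S T
    unfolding y_def
    by (rule integrable_slab_continuous[OF continuous_on_mult[OF cvp continuous_on_mult[OF c\<psi> cw[OF that]]] K])
      (simp add: supp)
  have ih: "set_integrable lborel (slab S) (h T)" if "T > 0" for S T
    unfolding h_def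
    by (rule integrable_slab_continuous[OF continuous_on_mult[OF v(1) continuous_on_mult[OF c\<psi> cw[OF that]]] K])
      (simp add: supp)
  have w01: "0 < 1 - snd w / T \<and> 1 - snd w / T \<le> 1" if "w \<in> slab T" for w :: "'a \<times> real" and T
    using that by (auto simp: field_simps)
  have f0: "f w \<ge> 0" and g0: "g w \<ge> 0" for w
    using v(2) \<psi>(2) by (auto simp: f_def g_def)
  have y_f: "y T w = f w * (1 - snd w / T) ^ (n + 2)" and h_g: "h T w = g w * (1 - snd w / T) ^ n" for T w
    by (simp_all add: f_def g_def y_def h_def del: power_Suc)
  have y0: "0 \<le> y T w" "y T w \<le> f w" if "w \<in> slab T" for w T
  proof -
    have "0 \<le> (1 - snd w / T) ^ (n + 2)" "(1 - snd w / T) ^ (n + 2) \<le> 1"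
      using w01[OF that] by (auto intro!: power_le_one zero_le_power simp del: power_Suc)
    then show "0 \<le> y T w" "y T w \<le> f w"
      unfolding y_f using f0[of w] mult_left_mono[of _ 1 "f w"] by auto
  qed
  have h_le: "h T w \<le> g w" if "w \<in> slab T" for w T
  proof -
    have "(1 - snd w / T) ^ n \<le> 1" using w01[OF that] by (intro power_le_one) auto
    then show ?thesis unfolding h_g using g0[of w] mult_left_mono[of _ 1 "g w"] by auto
  qed
  \<comment> \<open>\<open>p * \<gamma> \<le> 1\<close> is exactly \<open>(1 - \<gamma>) / (p - 1) \<ge> \<gamma>\<close>, which keeps the error term within
    the scaling \<open>T powr (1 - \<gamma>)\<close> of the memory term after integrating over time.\<close>
  have young: "h T w \<le> T powr (1 - \<gamma>) * (B * y T w) + (B powr (- q) * T powr (- \<gamma>)) * \<psi> (fst w)"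
    if T: "T \<ge> 1" and B: "B > 0" and w: "w \<in> slab T" for T B w
  proof -
    have "T powr ((1 - \<gamma>) * (- q)) \<le> T powr (- \<gamma>)"
    proof (rule powr_mono)
      have "\<gamma> * (p - 1) \<le> 1 - \<gamma>" using p by (simp add: algebra_simps)
      then show "(1 - \<gamma>) * (- q) \<le> - \<gamma>" using p by (simp add: q_def field_simps)
    qed (use T in auto)
    then have err: "(T powr (1 - \<gamma>) * B) powr (- q) \<le> B powr (- q) * T powr (- \<gamma>)"
      using B T by (simp add: powr_mult powr_powr mult.commute mult_left_mono)
    have "v (fst w) (snd w) * (1 - snd w / T) ^ n
        \<le> (T powr (1 - \<gamma>) * B) * (v (fst w) (snd w) powr p * (1 - snd w / T) ^ (n + 2))
          + (T powr (1 - \<gamma>) * B) powr (- q)"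
      unfolding q_def by (rule weighted_young) (use v w01[OF w] B T p n in auto)
    also have "\<dots> \<le> (T powr (1 - \<gamma>) * B) * (v (fst w) (snd w) powr p * (1 - snd w / T) ^ (n + 2))
          + B powr (- q) * T powr (- \<gamma>)"
      using err by simp
    finally show ?thesis
      using mult_left_mono[OF _ \<psi>(2)[of "fst w"]] unfolding h_def y_def
      by (fastforce simp: algebra_simps simp del: power_Suc power_add)
  qed
  have int_\<psi>: "(LINT w:slab T|lborel. \<psi> (fst w)) = T * \<Psi>" if "T \<ge> 0" for T
    unfolding \<Psi>_def by (rule integral_slab_const_in_time[OF \<psi>(1) K supp that])
  \<comment> \<open>Integrating the error of size \<open>T powr (- \<gamma>)\<close> over a time
    span \<open>T\<close> lands on the scale of the memory term.\<close>
  have T\<gamma>: "T powr (- \<gamma>) * T = T powr (1 - \<gamma>)" if "T \<ge> 1" for T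
    using that powr_add[of T "- \<gamma>" 1] by simp

  show ?thesis
  proof (rule absorption[where \<alpha> = "1 - \<gamma>" and q = q and L = L and k = "1 / 2 ^ (n + 2)" and m = "real (n + 2)"
        and E = E and Y = Y and Q = Q and G = G and \<Psi> = \<Psi> and c = c])
    show "1 - \<gamma> > 0" "q > 0" "(1 :: real) / 2 ^ (n + 2) > 0" "real (n + 2) > 0"
      using \<gamma> p by (auto simp: q_def)
    show "E s \<le> E t" if "1 \<le> s" "s \<le> t" for s t
    proof -
      have "E s = (LINT w:slab t|lborel. indicator (slab s) w * f w)"
        unfolding E_def by (rule slab_indicator_integral[OF that(2), symmetric])
      also have "\<dots> \<le> E t"
        unfolding E_def using f0
        by (intro set_integral_mono slab_indicator_integrable if') (auto simp: indicator_def)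
      finally show ?thesis .
    qed
    show "Y T \<ge> 0" for T
      unfolding Y_def set_lebesgue_integral_def
    proof (rule Bochner_Integration.integral_nonneg)
      show "0 \<le> indicator (slab T) w *\<^sub>R y T w" for w
        using y0(1)[of w T] by (cases "w \<in> slab T") auto
    qed
    show "Y T \<le> E T" if "T \<ge> 1" for T
      unfolding Y_def E_def using that by (intro set_integral_mono iy if' y0) auto
    show "1 / 2 ^ (n + 2) * E (T / 2) \<le> Y T" if T: "T \<ge> 2" for T
    proof -
      have "1 / 2 ^ (n + 2) * E (T / 2) = (LINT w:slab T|lborel. 1 / 2 ^ (n + 2) * (indicator (slab (T / 2)) w * f w))"
        unfolding E_def using T by (subst set_integral_mult_right) (simp add: slab_indicator_integral)
      also have "\<dots> \<le> Y T"
        unfolding Y_def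
      proof (rule set_integral_mono[OF set_integrable_mult_right[OF slab_indicator_integrable[OF if']] iy])
        fix w :: "'a \<times> real" assume w: "w \<in> slab T"
        show "1 / 2 ^ (n + 2) * (indicator (slab (T / 2)) w * f w) \<le> y T w"
        proof (cases "w \<in> slab (T / 2)")
          case True
          \<comment> \<open>On the first half of the time interval the cutoff is at least one half,
            whence the constant \<open>1 / 2 ^ (n + 2)\<close>.\<close>
          then have "1 / 2 \<le> 1 - snd w / T" using T by (auto simp: field_simps)
          then have "(1 / 2) ^ (n + 2) \<le> (1 - snd w / T) ^ (n + 2)" by (rule power_mono) simp
          from mult_left_mono[OF this f0[of w]] show ?thesis
            unfolding y_f using True by (simp add: power_one_over del: power_Suc add_2_eq_Suc')
        qed (use y0[OF w] in simp)
      qed (use T in simp)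
      finally show ?thesis .
    qed
    show "c + T powr (1 - \<gamma>) / real (n + 2) * Y T \<le> L * Q T" if "T \<ge> 1" for T
      using H[OF that] unfolding Y_def Q_def y_def h_def .
    show "Q T \<le> T powr (1 - \<gamma>) * (B * Y T + B powr (- q) * \<Psi>)" if T: "T \<ge> 1" and B: "B > 0" for T B
    proof -
      have "Q T \<le> (LINT w:slab T|lborel. T powr (1 - \<gamma>) * (B * y T w) + (B powr (- q) * T powr (- \<gamma>)) * \<psi> (fst w))"
        unfolding Q_def using T B
        by (intro set_integral_mono ih young set_integral_add set_integrable_mult_right iy i\<psi>) auto
      also have "\<dots> = T powr (1 - \<gamma>) * (B * Y T) + (B powr (- q) * T powr (- \<gamma>)) * (T * \<Psi>)"
        using T by (simp add: set_integral_add set_integrable_mult_right iy i\<psi> int_\<psi> Y_def)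
      also have "\<dots> = T powr (1 - \<gamma>) * (B * Y T + B powr (- q) * \<Psi>)"
        unfolding T\<gamma>[OF T, symmetric] by (simp add: algebra_simps)
      finally show ?thesis .
    qed
    show "Q T \<le> G A + T powr (1 - \<gamma>) * (B * (E T - E A) + B powr (- q) * \<Psi>)"
      if A: "1 \<le> A" "A \<le> T" and B: "B > 0" for A T B
    proof -
      have T: "T \<ge> 1" using A by simp
      let ?r = "\<lambda>w. T powr (1 - \<gamma>) * (B * (f w - indicator (slab A) w * f w))"
      note ints = slab_indicator_integrable[OF ig[of T], of A]
        slab_indicator_integrable[OF if'[of T], of A] if'[of T] i\<psi>[of T]
      have ir: "set_integrable lborel (slab T) ?r"
        by (intro set_integrable_mult_right set_integral_diff ints)
      have "Q T \<le> (LINT w:slab T|lborel. (indicator (slab A) w * g w + ?r w) + (B powr (- q) * T powr (- \<gamma>)) * \<psi> (fst w))"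
        unfolding Q_def
      proof (rule set_integral_mono[OF ih])
        show "set_integrable lborel (slab T)
            (\<lambda>w. (indicator (slab A) w * g w + ?r w) + (B powr (- q) * T powr (- \<gamma>)) * \<psi> (fst w))"
          by (intro set_integral_add set_integrable_mult_right ints ir)
        fix w :: "'a \<times> real" assume w: "w \<in> slab T"
        have e: "(B powr (- q) * T powr (- \<gamma>)) * \<psi> (fst w) \<ge> 0" using \<psi>(2) by simp
        \<comment> \<open>Before time \<open>A\<close> the cutoff is merely dropped, at a cost free
          of \<open>B\<close> and \<open>T\<close>; afterwards \<open>young\<close> applies, and the
          indicator difference leaves only the tail of the energy.\<close>
        show "h T w \<le> (indicator (slab A) w * g w + ?r w) + (B powr (- q) * T powr (- \<gamma>)) * \<psi> (fst w)"
        proof (cases "w \<in> slab A")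
          case True then show ?thesis using h_le[OF w] e by simp
        next
          case False
          have "T powr (1 - \<gamma>) * (B * y T w) \<le> T powr (1 - \<gamma>) * (B * f w)"
            using y0[OF w] B by (intro mult_left_mono) auto
          then show ?thesis using False young[OF T B w] by simp
        qed
      qed (use T in simp)
      also have "\<dots> = (LINT w:slab T|lborel. indicator (slab A) w * g w) + (LINT w:slab T|lborel. ?r w)
          + (LINT w:slab T|lborel. (B powr (- q) * T powr (- \<gamma>)) * \<psi> (fst w))"
        by (subst set_integral_add(2), (intro set_integral_add set_integrable_mult_right ints ir)+)
          (subst set_integral_add(2), (intro ints ir)+, rule refl)
      also have "(LINT w:slab T|lborel. indicator (slab A) w * g w) = G A"
        unfolding G_def by (rule slab_indicator_integral[OF A(2)])
      also have "(LINT w:slab T|lborel. ?r w) = T powr (1 - \<gamma>) * (B * (E T - E A))"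
        unfolding E_def slab_indicator_integral[OF A(2), of f, symmetric]
        by (simp add: set_integral_diff(2) ints)
      also have "(LINT w:slab T|lborel. (B powr (- q) * T powr (- \<gamma>)) * \<psi> (fst w)) = T powr (1 - \<gamma>) * (B powr (- q) * \<Psi>)"
        unfolding T\<gamma>[OF T, symmetric] using T by (simp add: int_\<psi>)
      finally show ?thesis by (simp add: algebra_simps)
    qed
  qed (fact L c)+
qed

section \<open>Positivity of the initial mass and conclusion\<close>

lemma integral_pos_of_continuous:
  fixes f :: "'a::euclidean_space \<Rightarrow> real"
  assumes f: "continuous_on UNIV f" "\<And>x. f x \<ge> 0" and K: "compact K" "\<And>x. x \<notin> K \<Longrightarrow> f x = 0"
    and a: "f a > 0"
  shows "(LINT x|lborel. f x) > 0"
proof -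
  have "set_integrable lborel K f"
    by (rule borel_integrable_compact[OF K(1) continuous_on_subset[OF f(1)], folded set_integrable_def]) auto
  moreover have "indicator K x *\<^sub>R f x = f x" for x
    using K(2)[of x] by (cases "x \<in> K") auto
  ultimately have int: "integrable lborel f" unfolding set_integrable_def by (simp only:)
  have "(LINT x|lborel. f x) \<noteq> 0"
  proof
    assume "(LINT x|lborel. f x) = 0"
    then have "AE x in lborel. f x = 0"
      using integral_nonneg_eq_0_iff_AE[OF int] f(2) by simp
    \<comment> \<open>A vanishing integral would make the open set of positivity a null set, yet it
      contains a ball around \<open>a\<close>.\<close>
    then have "AE x in lborel. x \<notin> {x. f x > 0}" by eventually_elim simp
    moreover have op: "open {x. f x > 0}"
      using f(1) by (intro open_Collect_less) auto
    ultimately have "emeasure lborel {x. f x > 0} = 0"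
      by (subst (asm) AE_iff_measurable[OF _ refl]) auto
    moreover obtain e where e: "e > 0" "ball a e \<subseteq> {x. f x > 0}"
      using op a open_contains_ball[of "{x. f x > 0}"] by auto
    ultimately have "emeasure lborel (ball a e) = 0"
      using emeasure_mono[OF e(2), of lborel] op by simp
    then show False
      using content_ball_pos[OF e(1), of a] by (simp add: measure_def)
  qed
  moreover have "(LINT x|lborel. f x) \<ge> 0" using f(2) by simp
  ultimately show ?thesis by simp
qed

theorem theorem5:
  fixes u0 :: "(real^'n::finite) \<times> (real^'k::finite) \<Rightarrow> real"
    and \<gamma> p1 p2 :: real
  assumes "0 \<le> \<gamma>" and "\<gamma> < 1" and "p1 > 1" and "p2 > 1"
    and "C0 u0" and "\<forall>z. u0 z \<ge> 0" and "\<exists>z. u0 z \<noteq> 0"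
    and "p1 * \<gamma> \<le> 1"
  shows "\<not> (\<exists>u :: (real^'n) \<times> (real^'k) \<Rightarrow> real \<Rightarrow> real.
            C_C0 u \<and> (\<forall>z t. t \<ge> 0 \<longrightarrow> u z t \<ge> 0) \<and> global_weak_solution \<gamma> p1 p2 u0 u)"
proof
  assume "\<exists>u :: (real^'n) \<times> (real^'k) \<Rightarrow> real \<Rightarrow> real.
            C_C0 u \<and> (\<forall>z t. t \<ge> 0 \<longrightarrow> u z t \<ge> 0) \<and> global_weak_solution \<gamma> p1 p2 u0 u"
  then obtain u :: "(real^'n) \<times> (real^'k) \<Rightarrow> real \<Rightarrow> real" where u: "C_C0 u"
    "\<And>z t. t \<ge> 0 \<Longrightarrow> u z t \<ge> 0" and sol: "\<And>T. T > 0 \<Longrightarrow> weak_solution \<gamma> p1 p2 u0 T u"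
    unfolding global_weak_solution_def by blast
  obtain z0 where z0: "u0 z0 \<noteq> 0" using assms(7) by blast
  \<comment> \<open>The radius puts both components of \<open>z0\<close> strictly inside the balls
    on which the factors of the bump are positive, so that \<open>c > 0\<close>.\<close>
  define r where "r = norm z0 + 1"
  \<comment> \<open>Rounding up gives an integer exponent satisfying the condition of
    \<open>weighted_young\<close>.\<close>
  define n where "n = nat \<lceil>2 / (p1 - 1)\<rceil>"
  define K :: "((real^'n) \<times> (real^'k)) set" where "K = cball 0 \<bar>r\<bar> \<times> cball 0 \<bar>r\<bar>"
  define c where "c = (LINT z|lborel. u0 z * bump r z)"
  have r: "r > 0" by (simp add: r_def add_nonneg_pos)
  obtain L0 where L0: "L0 \<ge> 0" "\<And>z :: (real^'n) \<times> (real^'k). lbump r z \<ge> - L0 * bump r z"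
    using lbump_lower[OF r] by blast
  have K: "compact K" unfolding K_def by (intro compact_Times compact_cball)
  have bump_K: "bump r z = 0" if "z \<notin> K" for z
    using that bump_outside unfolding K_def by blast
  have "c > 0"
    unfolding c_def
  proof (rule integral_pos_of_continuous[OF _ _ K])
    show "continuous_on UNIV (\<lambda>z. u0 z * bump r z)"
      using assms(5) by (intro continuous_on_mult continuous_on_bump) (simp add: C0_def)
    have "norm (fst z0) < r" "norm (snd z0) < r"
      using norm_fst_le[of "fst z0" "snd z0"] norm_snd_le[of "snd z0" "fst z0"] by (auto simp: r_def)
    moreover have "u0 z0 > 0" using z0 spec[OF assms(6), of z0] by linarith
    ultimately show "u0 z0 * bump r z0 > 0" by (simp add: bump_pos)
  qed (use assms(6) bump_K in auto)
  moreover have "c \<le> 0"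
  proof (rule cutoff_inequality_imp_nonpos[where v = "\<lambda>z t. u z (max 0 t)" and \<psi> = "bump r"
        and L = "L0 + real (Suc n)" and n = n and \<gamma> = \<gamma> and p = p1])
    show "2 / (p1 - 1) \<le> real n" unfolding n_def by linarith
    show "continuous_on UNIV (\<lambda>w. u (fst w) (max 0 (snd w)))" by (rule C_C0_continuous[OF u(1)])
    show "c + T powr (1 - \<gamma>) / real (n + 2) * (LINT w:slab T|lborel.
          u (fst w) (max 0 (snd w)) powr p1 * (bump r (fst w) * (1 - snd w / T) ^ (n + 2)))
        \<le> (L0 + real (Suc n)) * (LINT w:slab T|lborel.
          u (fst w) (max 0 (snd w)) * (bump r (fst w) * (1 - snd w / T) ^ n))" if "T \<ge> 1" for T
      unfolding c_def
      by (rule weak_solution_cutoff_ineq[OF assms(1-3) that u sol L0]) (use that in auto)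
  qed (use assms L0 \<open>c > 0\<close> u(2) K bump_K continuous_on_bump in auto)
  ultimately show False by simp
qed

end
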